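(* Let $\mathcal{U}\subset\mathbb{C}^n$ be an open neighbourhood of the origin $\mathbf{0}$, let $\mathcal{F}$ be a holomorphic foliation of complex dimension $d$, $1\le d<n$, on $\mathcal{U}$ whose unique singular point is $\mathbf{0}$, and let $g:\mathcal{U}\to\mathbb{R}$ be a smooth Morse function whose unique critical point is $\mathbf{0}$, of Morse index $0$. Let $M=M(\mathcal{F},g)$ be the polar variety of $\mathcal{F}$ relative to $g$ and $M^*=M\setminus\{\mathbf{0}\}$. Then $\mathcal{F}$ carries the Morse structure of $g$ if and only if $M^*$ is a smooth, reduced submanifold of $\mathbb{C}^n$ of (real) codimension $2d$ and $M^*$ is everywhere transversal to $\mathcal{F}$.
   Context: $n\ge 2$ and $\mathbb{C}^n$ is identified with $\mathbb{R}^{2n}$. Thus $\mathcal{F}$ is a regular holomorphic foliation of complex dimension $d$ on $\mathcal{U}\setminus\{\mathbf{0}\}$, and a leaf of $\mathcal{F}$ means a leaf in $\mathcal{U}\setminus\{\mathbf{0}\}$; leaves are complex manifolds of complex dimension $d$ (real dimension $2d$). Carrying the Morse structure: $\mathcal{F}$ carries the Morse structure of $g$ if for every leaf $\mathcal{L}$ the restriction $g|_{\mathcal{L}}$ is a Morse function on $\mathcal{L}$, i.e. all its critical points are non-degenerate. Polar variety: $M=M(\mathcal{F},g)$ is the union of $\{\mathbf{0}\}$ with the set of points $\mathbf{z}\in\mathcal{U}\setminus\{\mathbf{0}\}$ at which the leaf $\mathcal{L}_{\mathbf{z}}$ through $\mathbf{z}$ is tangent to the level hypersurface of $g$ through $\mathbf{z}$,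 i.e. $\mathrm{Re}\langle v,\nabla g(\mathbf{z})\rangle=0$ for all $v\in T_{\mathbf{z}}\mathcal{L}_{\mathbf{z}}$. Equivalently, $M\setminus\{\mathbf{0}\}$ is the set of critical points of the restrictions of $g$ to the leaves. Reduced: near a point of $\mathcal{U}\setminus\{\mathbf{0}\}$ choose holomorphic coordinates $(z_1,\dots,z_n)$ in which the leaves are $\{z_{d+1}=c_{d+1},\dots,z_n=c_n\}$. Then $M^*$ is locally the common zero set of the functions $\partial g/\partial z_j,\ \partial g/\partial\bar z_j$, $1\le j\le d$ (equivalently, of the $2d$ partial derivatives of $g$ with respect to the real and imaginary parts of $z_1,\dots,z_d$). "$M^*$ is a reduced submanifold of codimension $2d$" means that it is a submanifold of codimension $2d$ with its multiplicity-one structure with respect to these equations: at every point of $M^*$ the Jacobian of these $2d$ defining functions, with respect to all $2n$ real coordinates, has rank $2d$. Transversality of $M^*$ to $\mathcal{F}$ at $\mathbf{z}$ means $T_{\mathbf{z}}M^*+T_{\mathbf{z}}\mathcal{L}_{\mathbf{z}}=\mathbb{R}^{2n}$. The set $M^*$ is allowed to be empty. *)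

theory Defs
  imports "HOL-Analysis.Analysis"
begin

section \<open>Smooth maps, submanifolds, Morse functions\<close>

text \<open>The following two notions are only used for open sets \<open>S\<close>.\<close>

primrec Ck_on :: "nat \<Rightarrow> 'a::real_normed_vector set \<Rightarrow> ('a \<Rightarrow> 'b::real_normed_vector) \<Rightarrow> bool" where
  "Ck_on 0 S f \<longleftrightarrow> continuous_on S f"
| "Ck_on (Suc k) S f \<longleftrightarrow>
     (\<forall>x\<in>S. f differentiable (at x)) \<and> (\<forall>v. Ck_on k S (\<lambda>x. frechet_derivative f (at x) v))"

definition smooth_on :: "'a::real_normed_vector set \<Rightarrow> ('a \<Rightarrow> 'b::real_normed_vector) \<Rightarrow> bool" where
  "smooth_on S f \<longleftrightarrow> (\<forall>k. Ck_on k S f)"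

definition diffeomorphism ::
  "'a::real_normed_vector set \<Rightarrow> 'b::real_normed_vector set \<Rightarrow> ('a \<Rightarrow> 'b) \<Rightarrow> bool" where
  "diffeomorphism V W \<Phi> \<longleftrightarrow>
     open V \<and> open W \<and> bij_betw \<Phi> V W \<and> smooth_on V \<Phi> \<and> smooth_on W (inv_into V \<Phi>)"

definition smooth_submanifold :: "nat \<Rightarrow> 'a::euclidean_space set \<Rightarrow> bool" where
  "smooth_submanifold codim S \<longleftrightarrow>
     (\<forall>p\<in>S. \<exists>V W (\<Phi> :: 'a \<Rightarrow> 'a) T.
        p \<in> V \<and> diffeomorphism V W \<Phi> \<and> subspace T \<and> dim T + codim = DIM('a) \<and>
        \<Phi> ` (S \<inter> V) = W \<inter> T)"

text \<open>Velocities of smooth curves lying in \<open>S\<close>; used for embedded submanifolds.\<close>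

definition tangent_space :: "'a::euclidean_space set \<Rightarrow> 'a \<Rightarrow> 'a set" where
  "tangent_space S p =
     {v. \<exists>e>0. \<exists>\<gamma>. smooth_on {-e<..<e} \<gamma> \<and> \<gamma> ` {-e<..<e} \<subseteq> S \<and> \<gamma> 0 = p \<and>
           (\<gamma> has_vector_derivative v) (at (0::real))}"

definition gradient :: "('a::euclidean_space \<Rightarrow> real) \<Rightarrow> 'a \<Rightarrow> 'a" where
  "gradient f p = (THE D. GDERIV f p :> D)"

definition critical_point :: "('a::euclidean_space \<Rightarrow> real) \<Rightarrow> 'a \<Rightarrow> bool" where
  "critical_point f p \<longleftrightarrow> (\<forall>v. frechet_derivative f (at p) v = 0)"

definition hessian :: "('a::euclidean_space \<Rightarrow> real) \<Rightarrow> 'a \<Rightarrow> 'a \<Rightarrow> 'a \<Rightarrow> real" where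
  "hessian f p v w = frechet_derivative (\<lambda>x. frechet_derivative f (at x) v) (at p) w"

definition nondegenerate :: "('a::euclidean_space \<Rightarrow> real) \<Rightarrow> 'a \<Rightarrow> bool" where
  "nondegenerate f p \<longleftrightarrow> (\<forall>v. (\<forall>w. hessian f p v w = 0) \<longrightarrow> v = 0)"

definition Morse_function :: "'a::euclidean_space set \<Rightarrow> ('a \<Rightarrow> real) \<Rightarrow> bool" where
  "Morse_function S f \<longleftrightarrow> smooth_on S f \<and> (\<forall>p\<in>S. critical_point f p \<longrightarrow> nondegenerate f p)"

definition Morse_index :: "('a::euclidean_space \<Rightarrow> real) \<Rightarrow> 'a \<Rightarrow> nat" where
  "Morse_index f p = Max {dim S | S. subspace S \<and> (\<forall>v\<in>S. v \<noteq> 0 \<longrightarrow> hessian f p v v < 0)}"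

section \<open>Holomorphic foliations\<close>

definition holomorphic_map :: "(complex^'m) set \<Rightarrow> (complex^'m \<Rightarrow> complex^'n) \<Rightarrow> bool" where
  "holomorphic_map V f \<longleftrightarrow> smooth_on V f \<and>
     (\<forall>z\<in>V. \<forall>c v. frechet_derivative f (at z) (c *s v) = c *s frechet_derivative f (at z) v)"

text \<open>A chart of a foliation of complex dimension \<open>d = CARD('d)\<close> on an open subset of
  \<open>\<complex>\<^sup>n\<close>, \<open>n = CARD('n) = CARD('d) + CARD('q)\<close>, is a coordinate domain together with coordinates
  indexed by \<open>'d + 'q\<close>: the \<open>Inl\<close>-coordinates are \<open>z\<^sub>1, \<dots>, z\<^sub>d\<close> (along the leaves), the
  \<open>Inr\<close>-coordinates are \<open>z\<^bsub>d+1\<^esub>, \<dots>, z\<^sub>n\<close> (constant on the plaques).\<close>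

type_synonym ('n, 'd, 'q) chart = "(complex^'n) set \<times> (complex^'n \<Rightarrow> complex^('d + 'q))"

definition leaf_coords :: "complex^('d::finite + 'q::finite) \<Rightarrow> complex^'d" where
  "leaf_coords w = (\<chi> j. w $ Inl j)"

definition transverse_coords :: "complex^('d::finite + 'q::finite) \<Rightarrow> complex^'q" where
  "transverse_coords w = (\<chi> k. w $ Inr k)"

definition join_coords :: "complex^'d \<Rightarrow> complex^'q \<Rightarrow> complex^('d::finite + 'q::finite)" where
  "join_coords x y = (\<chi> i. case i of Inl j \<Rightarrow> x $ j | Inr k \<Rightarrow> y $ k)"

definition polydisc :: "complex^'n \<Rightarrow> real^'n \<Rightarrow> (complex^'n) set" where
  "polydisc c r = {w. \<forall>k. w $ k \<in> ball (c $ k) (r $ k)}"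

text \<open>The image is a polydisc, so that the plaques (slices) are connected.\<close>

definition foliated_chart :: "('n::finite, 'd::finite, 'q::finite) chart \<Rightarrow> bool" where
  "foliated_chart = (\<lambda>(V, \<phi>). open V \<and> inj_on \<phi> V \<and> holomorphic_map V \<phi> \<and>
     (\<exists>c r. (\<forall>k. r $ k > 0) \<and> \<phi> ` V = polydisc c r) \<and>
     holomorphic_map (\<phi> ` V) (inv_into V \<phi>))"

text \<open>Locally on the overlap the two charts have the same plaques, i.e.\ the coordinate change has
  the form \<open>(x, y) \<mapsto> (a(x, y), b(y))\<close> with \<open>b\<close> injective.\<close>

definition compatible :: "('n::finite, 'd::finite, 'q::finite) chart \<Rightarrow> ('n::finite, 'd::finite, 'q::finite) chart \<Rightarrow> bool" where
  "compatible = (\<lambda>(V, \<phi>) (V', \<phi>').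
     \<forall>z \<in> V \<inter> V'. \<exists>W. open W \<and> z \<in> W \<and> W \<subseteq> V \<inter> V' \<and>
       (\<forall>u\<in>W. \<forall>w\<in>W. transverse_coords (\<phi> u) = transverse_coords (\<phi> w) \<longleftrightarrow>
                     transverse_coords (\<phi>' u) = transverse_coords (\<phi>' w)))"

definition regular_holomorphic_foliation ::
  "(complex^'n) set \<Rightarrow> ('n::finite, 'd::finite, 'q::finite) chart set \<Rightarrow> bool" where
  "regular_holomorphic_foliation W \<F> \<longleftrightarrow>
     (\<forall>c\<in>\<F>. foliated_chart c) \<and> (\<Union>c\<in>\<F>. fst c) = W \<and> (\<forall>c\<in>\<F>. \<forall>c'\<in>\<F>. compatible c c')"

text \<open>\<open>p\<close> is singular if the foliation has no extension to a regular foliation around \<open>p\<close>.\<close>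

definition singular_point :: "('n::finite, 'd::finite, 'q::finite) chart set \<Rightarrow> complex^'n \<Rightarrow> bool" where
  "singular_point \<F> p \<longleftrightarrow>
     \<not> (\<exists>c. foliated_chart c \<and> p \<in> fst c \<and> (\<forall>c'\<in>\<F>. compatible c c'))"

text \<open>The leaves are the equivalence classes under chains of plaques.\<close>

definition plaque_rel :: "('n::finite, 'd::finite, 'q::finite) chart set \<Rightarrow> (complex^'n) rel" where
  "plaque_rel \<F> = {(z, w). \<exists>(V, \<phi>)\<in>\<F>. z \<in> V \<and> w \<in> V \<and>
     transverse_coords (\<phi> z) = transverse_coords (\<phi> w)}"

definition leaf :: "('n::finite, 'd::finite, 'q::finite) chart set \<Rightarrow> complex^'n \<Rightarrow> (complex^'n) set" where
  "leaf \<F> z = (plaque_rel \<F>)\<^sup>* `` {z}"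

definition leaves :: "(complex^'n) set \<Rightarrow> ('n::finite, 'd::finite, 'q::finite) chart set \<Rightarrow> (complex^'n) set set" where
  "leaves W \<F> = leaf \<F> ` W"

text \<open>The plaque through \<open>z\<close>, parametrized by the leaf coordinates. These are the (inverse) charts
  of the complex manifold structure of the leaves.\<close>

definition plaque_param :: "('n::finite, 'd::finite, 'q::finite) chart \<Rightarrow> complex^'n \<Rightarrow> complex^'d \<Rightarrow> complex^'n" where
  "plaque_param = (\<lambda>(V, \<phi>) z x. inv_into V \<phi> (join_coords x (transverse_coords (\<phi> z))))"

definition plaque_domain :: "('n::finite, 'd::finite, 'q::finite) chart \<Rightarrow> complex^'n \<Rightarrow> (complex^'d) set" where
  "plaque_domain = (\<lambda>(V, \<phi>) z. {x. join_coords x (transverse_coords (\<phi> z)) \<in> \<phi> ` V})"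

definition leaf_tangent_space :: "('n::finite, 'd::finite, 'q::finite) chart set \<Rightarrow> complex^'n \<Rightarrow> (complex^'n) set" where
  "leaf_tangent_space \<F> z =
     {v. \<exists>c\<in>\<F>. z \<in> fst c \<and>
        v \<in> range (frechet_derivative (plaque_param c z) (at (leaf_coords (snd c z))))}"

section \<open>Morse structure and polar variety\<close>

definition Morse_on_leaf ::
  "('n::finite, 'd::finite, 'q::finite) chart set \<Rightarrow> (complex^'n) set \<Rightarrow> (complex^'n \<Rightarrow> real) \<Rightarrow> bool" where
  "Morse_on_leaf \<F> L g \<longleftrightarrow>
     (\<forall>c\<in>\<F>. \<forall>z \<in> fst c \<inter> L. Morse_function (plaque_domain c z) (g \<circ> plaque_param c z))"

definition carries_Morse_structure ::
  "(complex^'n) set \<Rightarrow> ('n::finite, 'd::finite, 'q::finite) chart set \<Rightarrow> (complex^'n \<Rightarrow> real) \<Rightarrow> bool" where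
  "carries_Morse_structure U \<F> g \<longleftrightarrow> (\<forall>L \<in> leaves (U - {0}) \<F>. Morse_on_leaf \<F> L g)"

text \<open>The inner product of \<open>complex^'n\<close> as a real inner product space is the real part of the
  Hermitian product.\<close>

definition polar_variety ::
  "(complex^'n) set \<Rightarrow> ('n::finite, 'd::finite, 'q::finite) chart set \<Rightarrow> (complex^'n \<Rightarrow> real) \<Rightarrow> (complex^'n) set" where
  "polar_variety U \<F> g =
     {0} \<union> {z \<in> U - {0}. \<forall>v \<in> leaf_tangent_space \<F> z. v \<bullet> gradient g z = 0}"

text \<open>In the coordinates of a foliated chart, the \<open>2d\<close> partial derivatives of \<open>g\<close> with respect to
  the real and imaginary parts of \<open>z\<^sub>1, \<dots>, z\<^sub>d\<close>; they are stored as the real and imaginary parts of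
  the components of a vector in \<open>complex^'d\<close>.\<close>

definition polar_equations ::
  "('n::finite, 'd::finite, 'q::finite) chart \<Rightarrow> (complex^'n \<Rightarrow> real) \<Rightarrow> complex^('d::finite + 'q::finite) \<Rightarrow> complex^'d" where
  "polar_equations = (\<lambda>(V, \<phi>) g w.
     \<chi> j. Complex (frechet_derivative (g \<circ> inv_into V \<phi>) (at w) (axis (Inl j) 1))
                  (frechet_derivative (g \<circ> inv_into V \<phi>) (at w) (axis (Inl j) \<i>)))"

definition reduced_polar_variety ::
  "(complex^'n) set \<Rightarrow> ('n::finite, 'd::finite, 'q::finite) chart set \<Rightarrow> (complex^'n \<Rightarrow> real) \<Rightarrow> bool" where
  "reduced_polar_variety U \<F> g \<longleftrightarrow>
     (\<forall>(V, \<phi>)\<in>\<F>. \<forall>z \<in> V \<inter> (polar_variety U \<F> g - {0}).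
        dim (range (frechet_derivative (polar_equations (V, \<phi>) g) (at (\<phi> z)))) = 2 * CARD('d))"

definition transversal_to_foliation :: "(complex^'n) set \<Rightarrow> ('n::finite, 'd::finite, 'q::finite) chart set \<Rightarrow> bool" where
  "transversal_to_foliation S \<F> \<longleftrightarrow>
     (\<forall>z\<in>S. {u + v | u v. u \<in> tangent_space S z \<and> v \<in> leaf_tangent_space \<F> z} = UNIV)"

end

theory Submission
  imports Defs
begin

text \<open>
  Everything is decided in one foliated chart \<open>\<phi>\<close> with inverse \<open>\<psi>\<close>. Let \<open>P w \<in> \<complex>\<^sup>d\<close> be the vector
  of the polar equations; it is the leafwise gradient of \<open>g \<circ> \<psi>\<close>, in the sense that
  \<open>P w \<bullet> v = D(g \<circ> \<psi>)(w)(v, 0)\<close>. Three observations carry the proof.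

  First, the tangent space of the leaf at \<open>z\<close> is the preimage of \<open>\<complex>\<^sup>d \<times> 0\<close> under \<open>D\<phi>(z)\<close>, for every
  chart around \<open>z\<close> (\<open>leaf_tangent_space_eq_plaque\<close>). Hence in the chart \<open>M\<^sup>*\<close> is the zero set of \<open>P\<close>
  (\<open>polar_variety_in_chart\<close>).

  Second, differentiating the formula for \<open>P\<close> once more along the leaf shows that the Hessian of \<open>g\<close>
  on a plaque is \<open>(v, w) \<mapsto> A w \<bullet> v\<close>, where \<open>A\<close> is the restriction of \<open>DP\<close> to \<open>\<complex>\<^sup>d \<times> 0\<close>. A critical
  point is thus nondegenerate iff \<open>A\<close> is surjective, and \<open>\<F>\<close> carries the Morse structure of \<open>g\<close> iff
  \<open>A\<close> is surjective at all points of \<open>M\<^sup>*\<close> (\<open>Morse_on_plaques_iff\<close>).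

  Third, surjectivity of \<open>A\<close> is equivalent to the geometric conditions on \<open>M\<^sup>*\<close>. If \<open>A\<close> is surjective,
  so is \<open>DP\<close>, and \<open>M\<^sup>*\<close> is reduced. Moreover \<open>A\<close> is then bijective, so the map
  \<open>(x, y) \<mapsto> (P(x, y), y)\<close> has an injective derivative. By the inverse function theorem it is a local
  diffeomorphism; it takes \<open>M\<^sup>*\<close> to the linear space \<open>0 \<times> \<complex>\<^sup>q\<close>. So \<open>M\<^sup>*\<close> is a submanifold of
  codimension \<open>2d\<close>, and pulling back straight lines of \<open>0 \<times> \<complex>\<^sup>q\<close> gives curves in \<open>M\<^sup>*\<close> whose
  velocities have arbitrary transverse components, which is transversality. Conversely, \<open>DP\<close> kills
  the velocities of curves in \<open>M\<^sup>*\<close>. If these velocities together with the leaf directions span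
  everything, then \<open>DP\<close> and \<open>A\<close> have the same range, and this range is \<open>\<complex>\<^sup>d\<close> when \<open>M\<^sup>*\<close> is reduced.

  The calculus of smooth maps that this needs, up to smoothness of local inverses, comes first.\<close>

section \<open>Linear algebra\<close>

lemma linear_euclidean_expansion:
  fixes v :: "'a::euclidean_space"
  assumes "linear L"
  shows "L v = (\<Sum>b\<in>Basis. (v \<bullet> b) *\<^sub>R L b)"
proof -
  have "L v = L (\<Sum>b\<in>Basis. (v \<bullet> b) *\<^sub>R b)" by (simp add: euclidean_representation)
  also have "\<dots> = (\<Sum>b\<in>Basis. (v \<bullet> b) *\<^sub>R L b)"
    using assms by (simp add: linear_sum linear_scale)
  finally show ?thesis .
qed

text \<open>The gradient is defined as the unique vector that represents the derivative; this lemma supplies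
  its existence and uniqueness.\<close>

lemma inner_gradient:
  assumes "f differentiable (at z)"
  shows "v \<bullet> gradient f z = frechet_derivative f (at z) v"
proof -
  let ?F = "frechet_derivative f (at z)"
  have der: "(f has_derivative ?F) (at z)"
    using assms by (simp flip: frechet_derivative_works)
  define D where "D = (\<Sum>b\<in>Basis. ?F b *\<^sub>R b)"
  have F: "?F = (\<lambda>h. h \<bullet> D)"
  proof
    fix h
    show "?F h = h \<bullet> D"
      using linear_euclidean_expansion[OF has_derivative_linear[OF der], of h]
      by (simp add: D_def inner_sum_right mult.commute)
  qed
  then have D: "GDERIV f z :> D" using der by (simp add: gderiv_def)
  have "D' = D" if "GDERIV f z :> D'" for D'
  proof -
    have "(\<lambda>h. h \<bullet> D') = (\<lambda>h. h \<bullet> D)"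
      using that D has_derivative_unique unfolding gderiv_def by blast
    then have "h \<bullet> D' = h \<bullet> D" for h by meson
    then show ?thesis by (metis inner_commute vector_eq_ldot)
  qed
  with D have "gradient f z = D" unfolding gradient_def by (rule the_equality)
  then show ?thesis using F by metis
qed

text \<open>A proper subspace has a nonzero orthogonal vector. The right-hand side is nondegeneracy of the
  bilinear form \<open>A w \<bullet> v\<close> in the argument \<open>v\<close>, and the Hessian on a leaf will have this shape.\<close>

lemma linear_surj_iff_no_orthogonal_vector:
  fixes A :: "'a::euclidean_space \<Rightarrow> 'b::euclidean_space"
  assumes "linear A"
  shows "surj A \<longleftrightarrow> (\<forall>v. (\<forall>w. A w \<bullet> v = 0) \<longrightarrow> v = 0)"
proof
  assume "surj A"
  then show "\<forall>v. (\<forall>w. A w \<bullet> v = 0) \<longrightarrow> v = 0" by (metis inner_eq_zero_iff surjD)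
next
  assume *: "\<forall>v. (\<forall>w. A w \<bullet> v = 0) \<longrightarrow> v = 0"
  show "surj A"
  proof (rule ccontr)
    assume "\<not> surj A"
    moreover have sub: "span (range A) = range A"
      using assms by (simp add: linear_subspace_image span_eq_iff[THEN iffD2])
    ultimately have "dim (range A) < DIM('b)"
      by (metis dim_eq_full dim_subset_UNIV le_neq_implies_less)
    then obtain x where "x \<noteq> 0" "\<And>y. y \<in> span (range A) \<Longrightarrow> orthogonal x y"
      using orthogonal_to_subspace_exists by blast
    then show False using * by (metis inner_commute orthogonal_def rangeI span_base)
  qed
qed

section \<open>Calculus of \<open>C\<^sup>k\<close> maps on open sets\<close>

lemma Ck_on_cong:
  assumes "open S" "Ck_on k S f" "\<And>x. x \<in> S \<Longrightarrow> f x = g x"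
  shows "Ck_on k S g"
  using assms(2,3)
proof (induction k arbitrary: f g)
  case 0
  then show ?case by (simp cong: continuous_on_cong)
next
  case (Suc k)
  have diff: "f differentiable (at x)" if "x \<in> S" for x
    using Suc.prems that by auto
  have "g differentiable (at x)" if "x \<in> S" for x
    using diff[OF that] has_derivative_transform_within_open[OF _ assms(1) that] Suc.prems(2)
    unfolding differentiable_def by blast
  moreover have eq: "frechet_derivative f (at x) = frechet_derivative g (at x)" if "x \<in> S" for x
    using frechet_derivative_transform_within_open[OF diff[OF that] assms(1) that Suc.prems(2)]
    by simp
  have "Ck_on k S (\<lambda>x. frechet_derivative g (at x) v)" for v
    by (rule Suc.IH[of "\<lambda>x. frechet_derivative f (at x) v"]) (use Suc.prems(1) eq in auto)
  ultimately show ?case by simp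
qed

lemma Ck_on_subset:
  assumes "Ck_on k S f" "T \<subseteq> S"
  shows "Ck_on k T f"
  using assms(1)
proof (induction k arbitrary: f)
  case 0
  then show ?case using assms(2) by (auto intro: continuous_on_subset)
next
  case (Suc k)
  then show ?case using assms(2) by auto
qed

text \<open>Any explicitly known derivative may replace \<^const>\<open>frechet_derivative\<close>; the inductions on \<open>k\<close> below
  all proceed through this rule.\<close>

lemma Ck_on_SucI:
  assumes "open S" "\<And>x. x \<in> S \<Longrightarrow> (f has_derivative f' x) (at x)"
    and "\<And>v. Ck_on k S (\<lambda>x. f' x v)"
  shows "Ck_on (Suc k) S f"
proof -
  have "f' x = frechet_derivative f (at x)" if "x \<in> S" for x
    using assms(2)[OF that] by (rule frechet_derivative_at)
  then have "Ck_on k S (\<lambda>x. frechet_derivative f (at x) v)" for v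
    using Ck_on_cong[OF assms(1) assms(3)[of v]] by simp
  moreover have "f differentiable (at x)" if "x \<in> S" for x
    using assms(2)[OF that] by (auto simp: differentiable_def)
  ultimately show ?thesis by simp
qed

lemma Ck_on_has_derivative:
  assumes "Ck_on (Suc k) S f" "x \<in> S"
  shows "(f has_derivative frechet_derivative f (at x)) (at x)"
  using assms by (auto intro: frechet_derivative_works[THEN iffD1])

lemma Ck_on_Suc_imp: "Ck_on (Suc k) S f \<Longrightarrow> Ck_on k S f"
proof (induction k arbitrary: f)
  case 0
  then show ?case
    by (simp add: continuous_at_imp_continuous_on differentiable_imp_continuous_within)
next
  case (Suc k)
  have "Ck_on k S (\<lambda>x. frechet_derivative f (at x) v)" for v
    by (rule Suc.IH) (use Suc.prems in \<open>subst (asm) Ck_on.simps(2), blast\<close>)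
  moreover have "\<forall>x\<in>S. f differentiable (at x)"
    using Suc.prems by (subst (asm) Ck_on.simps(2)) blast
  ultimately show ?case by (subst Ck_on.simps(2)) blast
qed

lemma Ck_on_mono:
  assumes "j \<le> k" "Ck_on k S f"
  shows "Ck_on j S f"
proof -
  have "Ck_on (j + i) S f \<Longrightarrow> Ck_on j S f" for i
  proof (induction i)
    case (Suc i)
    then show ?case using Ck_on_Suc_imp[of "j + i" S f] by (simp only: add_Suc_right)
  qed simp
  then show ?thesis using assms le_Suc_ex by blast
qed

lemma Ck_on_const: "Ck_on k S (\<lambda>x. c)"
  by (induction k arbitrary: c) auto

lemma Ck_on_bounded_linear:
  assumes "bounded_linear L"
  shows "Ck_on k S L"
proof (cases k)
  case 0
  then show ?thesis using assms by (simp add: linear_continuous_on)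
next
  case (Suc j)
  have "frechet_derivative L (at x) = L" for x
    using bounded_linear.has_derivative[OF assms has_derivative_ident]
    by (metis frechet_derivative_at)
  then show ?thesis
    using assms Suc by (simp add: Ck_on_const bounded_linear_imp_differentiable)
qed

lemma Ck_on_add:
  assumes "open S" "Ck_on k S f" "Ck_on k S g"
  shows "Ck_on k S (\<lambda>x. f x + g x)"
  using assms(2,3)
proof (induction k arbitrary: f g)
  case 0
  then show ?case by (auto intro: continuous_on_add)
next
  case (Suc k)
  show ?case
  proof (rule Ck_on_SucI[OF assms(1)])
    show "((\<lambda>x. f x + g x) has_derivative
        (\<lambda>v. frechet_derivative f (at x) v + frechet_derivative g (at x) v)) (at x)" if "x \<in> S" for x
      using Suc.prems that by (intro has_derivative_add Ck_on_has_derivative)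
    show "Ck_on k S (\<lambda>x. frechet_derivative f (at x) v + frechet_derivative g (at x) v)" for v
      using Suc.prems by (intro Suc.IH) auto
  qed
qed

lemma Ck_on_sum:
  assumes "open S" "\<And>i. i \<in> I \<Longrightarrow> Ck_on k S (f i)"
  shows "Ck_on k S (\<lambda>x. \<Sum>i\<in>I. f i x)"
  using assms(2)
  by (induction I rule: infinite_finite_induct) (auto intro!: Ck_on_const Ck_on_add assms(1))

lemma Ck_on_scaleR:
  assumes "open S" "Ck_on k S f" "Ck_on k S g"
  shows "Ck_on k S (\<lambda>x. f x *\<^sub>R g x)"
  using assms(2,3)
proof (induction k arbitrary: f g)
  case 0
  then show ?case by (auto intro: continuous_on_scaleR)
next
  case (Suc k)
  note low = Suc.prems[THEN Ck_on_Suc_imp]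
  show ?case
  proof (rule Ck_on_SucI[OF assms(1)])
    show "((\<lambda>x. f x *\<^sub>R g x) has_derivative
        (\<lambda>v. f x *\<^sub>R frechet_derivative g (at x) v + frechet_derivative f (at x) v *\<^sub>R g x)) (at x)"
      if "x \<in> S" for x
      using Suc.prems that by (intro has_derivative_scaleR Ck_on_has_derivative)
    show "Ck_on k S (\<lambda>x. f x *\<^sub>R frechet_derivative g (at x) v + frechet_derivative f (at x) v *\<^sub>R g x)" for v
      using Suc.prems low by (intro Ck_on_add[OF assms(1)] Suc.IH) auto
  qed
qed

lemma Ck_on_linear_compose:
  assumes "open S" "bounded_linear L" "Ck_on k S f"
  shows "Ck_on k S (\<lambda>x. L (f x))"
  using assms(3)
proof (induction k arbitrary: f)
  case 0
  then show ?case using assms(2) by (auto intro: bounded_linear.continuous_on)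
next
  case (Suc k)
  show ?case
  proof (rule Ck_on_SucI[OF assms(1)])
    show "((\<lambda>x. L (f x)) has_derivative (\<lambda>v. L (frechet_derivative f (at x) v))) (at x)"
      if "x \<in> S" for x
      using Ck_on_has_derivative[OF Suc.prems that]
      by (rule bounded_linear.has_derivative[OF assms(2)])
    show "Ck_on k S (\<lambda>x. L (frechet_derivative f (at x) v))" for v
      using Suc.prems by (intro Suc.IH) auto
  qed
qed

text \<open>Induction on \<open>k\<close>. The chain rule gives \<open>D(g \<circ> f)(x) v = Dg(f x)(Df(x) v)\<close>, in which the direction
  \<open>Df(x) v\<close> depends on \<open>x\<close>, whereas \<^const>\<open>Ck_on\<close> speaks of fixed directions. Expanding \<open>Df(x) v\<close>
  in the standard basis separates the two and leaves sums of products of \<open>C\<^sup>k\<close> functions.\<close>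

lemma Ck_on_compose:
  fixes f :: "'a::real_normed_vector \<Rightarrow> 'b::euclidean_space" and g :: "'b \<Rightarrow> 'c::real_normed_vector"
  assumes "open S" "f ` S \<subseteq> T" "Ck_on k S f" "Ck_on k T g"
  shows "Ck_on k S (\<lambda>x. g (f x))"
  using assms(3,4)
proof (induction k arbitrary: g)
  case 0
  then show ?case using assms(2) by (auto intro: continuous_on_compose2)
next
  case (Suc k)
  have fS: "f x \<in> T" if "x \<in> S" for x using assms(2) that by blast
  show ?case
  proof (rule Ck_on_SucI[OF assms(1)])
    show "((\<lambda>x. g (f x)) has_derivative
        (\<lambda>v. \<Sum>b\<in>Basis. (frechet_derivative f (at x) v \<bullet> b) *\<^sub>R frechet_derivative g (at (f x)) b)) (at x)"
      if "x \<in> S" for x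
    proof -
      have g: "(g has_derivative frechet_derivative g (at (f x))) (at (f x))"
        using Ck_on_has_derivative[OF Suc.prems(2) fS[OF that]] .
      show ?thesis
        using has_derivative_compose[OF Ck_on_has_derivative[OF Suc.prems(1) that] g]
        by (subst (asm) linear_euclidean_expansion[OF has_derivative_linear[OF g]])
    qed
    show "Ck_on k S (\<lambda>x. \<Sum>b\<in>Basis. (frechet_derivative f (at x) v \<bullet> b) *\<^sub>R frechet_derivative g (at (f x)) b)" for v
      using Suc.prems
      by (intro Ck_on_sum[OF assms(1)] Ck_on_scaleR[OF assms(1)] Suc.IH Ck_on_Suc_imp[OF Suc.prems(1)]
           Ck_on_linear_compose[OF assms(1) bounded_linear_inner_left]) auto
  qed
qed

lemma smooth_on_has_derivative:
  assumes "smooth_on S f" "x \<in> S"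
  shows "(f has_derivative frechet_derivative f (at x)) (at x)"
  using assms Ck_on_has_derivative unfolding smooth_on_def by blast

lemma smooth_on_frechet_derivative:
  assumes "smooth_on S f"
  shows "smooth_on S (\<lambda>x. frechet_derivative f (at x) v)"
  unfolding smooth_on_def
proof
  fix k
  show "Ck_on k S (\<lambda>x. frechet_derivative f (at x) v)"
    using assms[unfolded smooth_on_def, rule_format, of "Suc k"] by simp
qed

lemma smooth_on_cong:
  "open S \<Longrightarrow> smooth_on S f \<Longrightarrow> (\<And>x. x \<in> S \<Longrightarrow> f x = g x) \<Longrightarrow> smooth_on S g"
  unfolding smooth_on_def using Ck_on_cong by blast

lemma smooth_on_subset: "smooth_on S f \<Longrightarrow> T \<subseteq> S \<Longrightarrow> smooth_on T f"
  unfolding smooth_on_def using Ck_on_subset by blast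

lemma smooth_on_const: "smooth_on S (\<lambda>x. c)"
  unfolding smooth_on_def using Ck_on_const by blast

lemma smooth_on_bounded_linear: "bounded_linear L \<Longrightarrow> smooth_on S L"
  unfolding smooth_on_def using Ck_on_bounded_linear by blast

lemma smooth_on_add:
  "open S \<Longrightarrow> smooth_on S f \<Longrightarrow> smooth_on S g \<Longrightarrow> smooth_on S (\<lambda>x. f x + g x)"
  unfolding smooth_on_def using Ck_on_add by blast

lemma smooth_on_sum:
  "open S \<Longrightarrow> (\<And>i. i \<in> I \<Longrightarrow> smooth_on S (f i)) \<Longrightarrow> smooth_on S (\<lambda>x. \<Sum>i\<in>I. f i x)"
  unfolding smooth_on_def by (intro allI Ck_on_sum) auto

lemma smooth_on_scaleR:
  "open S \<Longrightarrow> smooth_on S f \<Longrightarrow> smooth_on S g \<Longrightarrow> smooth_on S (\<lambda>x. f x *\<^sub>R g x)"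
  unfolding smooth_on_def using Ck_on_scaleR by blast

lemma smooth_on_compose:
  fixes f :: "'a::real_normed_vector \<Rightarrow> 'b::euclidean_space" and g :: "'b \<Rightarrow> 'c::real_normed_vector"
  shows "open S \<Longrightarrow> f ` S \<subseteq> T \<Longrightarrow> smooth_on S f \<Longrightarrow> smooth_on T g \<Longrightarrow> smooth_on S (\<lambda>x. g (f x))"
  unfolding smooth_on_def using Ck_on_compose by blast

section \<open>The smooth inverse function theorem\<close>

text \<open>With \<open>u = N y0 v\<close> one has \<open>N y v - N y0 v = - N y (M y u - M y0 u)\<close>, so it is enough to bound \<open>N y\<close>
  near \<open>y0\<close>. If \<open>B\<close> is a lower bound of \<open>M y0\<close> on unit vectors and \<open>M y\<close> differs from \<open>M y0\<close> by less
  than \<open>B/2\<close> in operator norm, then \<open>2/B\<close> bounds \<open>N y\<close>.\<close>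

lemma inverse_family_continuous:
  fixes M N :: "'a::real_normed_vector \<Rightarrow> 'b::euclidean_space \<Rightarrow> 'b"
  assumes "open S" "y0 \<in> S"
    and lin: "\<And>y. y \<in> S \<Longrightarrow> linear (M y)"
    and cont: "\<And>b. continuous_on S (\<lambda>y. M y b)"
    and MN: "\<And>y x. y \<in> S \<Longrightarrow> M y (N y x) = x"
    and NM: "\<And>y x. y \<in> S \<Longrightarrow> N y (M y x) = x"
  shows "isCont (\<lambda>y. N y v) y0"
proof -
  obtain B where B: "B > 0" "\<And>x. B * norm x \<le> norm (M y0 x)"
    using linear_inj_bounded_below_pos[OF lin[OF assms(2)]] NM[OF assms(2)]
    by (metis injI)
  have contb: "((\<lambda>y. M y b) \<longlongrightarrow> M y0 b) (at y0)" for b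
    using cont[of b] assms(1,2) by (simp add: continuous_on_eq_continuous_at isCont_def)
  let ?D = "\<lambda>y. \<Sum>b\<in>Basis. norm (M y b - M y0 b)"
  have "(?D \<longlongrightarrow> (\<Sum>b\<in>(Basis::'b set). norm (M y0 b - M y0 b))) (at y0)"
    by (intro tendsto_intros contb)
  then have D0: "(?D \<longlongrightarrow> 0) (at y0)" by simp
  have D: "norm (M y x - M y0 x) \<le> norm x * ?D y" if "y \<in> S" for y x
  proof -
    have "M y x - M y0 x = (\<Sum>b\<in>Basis. (x \<bullet> b) *\<^sub>R (M y b - M y0 b))"
      using linear_euclidean_expansion[OF lin[OF that], of x]
        linear_euclidean_expansion[OF lin[OF assms(2)], of x]
      by (simp add: scaleR_right_diff_distrib sum_subtractf)
    also have "norm \<dots> \<le> (\<Sum>b\<in>Basis. norm x * norm (M y b - M y0 b))"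
      by (rule sum_norm_le) (simp add: Basis_le_norm mult_right_mono)
    finally show ?thesis by (simp add: sum_distrib_left)
  qed
  have "\<forall>\<^sub>F y in at y0. y \<in> S"
    using assms(1,2) by (simp add: eventually_at_in_open')
  moreover have "\<forall>\<^sub>F y in at y0. ?D y < B / 2"
    using order_tendstoD(2)[OF D0, of "B/2"] B(1) by simp
  \<comment> \<open>The cost \<open>norm x * (B / 2)\<close> of passing from \<open>M y0\<close> to \<open>M y\<close> is absorbed by \<open>B * norm x\<close>.\<close>
  ultimately have ev: "\<forall>\<^sub>F y in at y0. norm (N y v - N y0 v) \<le> (2 / B) * norm (M y (N y0 v) - M y0 (N y0 v))"
  proof eventually_elim
    case (elim y)
    define x where "x = N y v - N y0 v"
    have "M y x = M y0 (N y0 v) - M y (N y0 v)"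
      using elim lin MN assms(2) by (simp add: x_def linear_diff)
    then have "norm (M y x) = norm (M y (N y0 v) - M y0 (N y0 v))"
      by (simp add: norm_minus_commute)
    moreover have "norm (M y0 x) \<le> norm (M y x) + norm (M y x - M y0 x)"
      by (metis norm_minus_commute norm_triangle_sub)
    moreover have "norm (M y x - M y0 x) \<le> norm x * (B / 2)"
      using D[of y x] elim by (smt (verit) mult_left_mono norm_ge_zero)
    ultimately have "B * norm x \<le> norm (M y (N y0 v) - M y0 (N y0 v)) + norm x * (B / 2)"
      using B(2)[of x] by linarith
    then show ?case using B(1) by (simp add: x_def field_simps)
  qed
  have "((\<lambda>y. (2 / B) * norm (M y (N y0 v) - M y0 (N y0 v))) \<longlongrightarrow>
      (2 / B) * norm (M y0 (N y0 v) - M y0 (N y0 v))) (at y0)"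
    by (intro tendsto_intros contb)
  then have lim: "((\<lambda>y. (2 / B) * norm (M y (N y0 v) - M y0 (N y0 v))) \<longlongrightarrow> 0) (at y0)" by simp
  have "((\<lambda>y. N y v - N y0 v) \<longlongrightarrow> 0) (at y0)"
    using Lim_null_comparison[OF ev lim] .
  then show ?thesis unfolding isCont_def by (simp add: LIM_zero_iff)
qed

text \<open>A product rule for factors \<open>h\<close> that are merely continuous. The term that would contain the
  derivative of \<open>h\<close> has the factor \<open>f x = 0\<close>.\<close>

lemma has_derivative_scaleR_vanishing:
  fixes f :: "'a::real_normed_vector \<Rightarrow> real"
  assumes "(f has_derivative f') (at x)" "f x = 0" "isCont h x"
  shows "((\<lambda>y. f y *\<^sub>R h y) has_derivative (\<lambda>v. f' v *\<^sub>R h x)) (at x)"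
proof -
  have "bounded_linear f'" using assms(1) by (rule has_derivative_bounded_linear)
  then obtain K where K: "\<And>v. norm (f' v) \<le> norm v * K" "K \<ge> 0"
    using bounded_linear.nonneg_bounded by blast
  let ?R = "\<lambda>y. (f y - f x - f' (y - x)) /\<^sub>R norm (y - x)"
  have R: "(?R \<longlongrightarrow> 0) (at x)" using assms(1) by (simp add: has_derivative_at_within)
  have hx: "((\<lambda>y. h y - h x) \<longlongrightarrow> 0) (at x)"
    using assms(3) by (simp add: isCont_def LIM_zero)
  have T1: "((\<lambda>y. ?R y *\<^sub>R h y) \<longlongrightarrow> 0) (at x)"
    using tendsto_scaleR[OF R assms(3)[unfolded isCont_def]] by simp
  have T2: "((\<lambda>y. (f' (y - x) / norm (y - x)) *\<^sub>R (h y - h x)) \<longlongrightarrow> 0) (at x)"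
  proof (rule Lim_null_comparison)
    show "\<forall>\<^sub>F y in at x. norm ((f' (y - x) / norm (y - x)) *\<^sub>R (h y - h x)) \<le> K * norm (h y - h x)"
    proof (rule always_eventually, rule allI)
      fix y
      have "\<bar>f' (y - x) / norm (y - x)\<bar> \<le> K"
        using K(1)[of "y - x"] K(2) by (simp add: divide_le_eq mult.commute)
      then show "norm ((f' (y - x) / norm (y - x)) *\<^sub>R (h y - h x)) \<le> K * norm (h y - h x)"
        unfolding norm_scaleR real_norm_def by (rule mult_right_mono) simp
    qed
    show "((\<lambda>y. K * norm (h y - h x)) \<longlongrightarrow> 0) (at x)"
      using tendsto_mult_right_zero[OF tendsto_norm_zero[OF hx]] .
  qed
  \<comment> \<open>The difference quotient splits into the remainder of \<open>f\<close> times \<open>h\<close>, and \<open>f'\<close> times the variation of \<open>h\<close>.\<close>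
  have "((\<lambda>y. (f y *\<^sub>R h y - f x *\<^sub>R h x - f' (y - x) *\<^sub>R h x) /\<^sub>R norm (y - x)) \<longlongrightarrow> 0) (at x)"
    using tendsto_add[OF T1 T2] assms(2)
    by (simp add: algebra_simps divide_inverse)
  then show ?thesis
    unfolding has_derivative_at_within
    using bounded_linear_scaleR_left \<open>bounded_linear f'\<close>
    by (auto intro: bounded_linear_compose[of "\<lambda>r. r *\<^sub>R h x" f'])
qed

text \<open>Pointwise inverses of a \<open>C\<^sup>k\<close> family of linear isomorphisms form a \<open>C\<^sup>k\<close> family. The derivative of
  \<open>y \<mapsto> N y v\<close> in direction \<open>w\<close> is \<open>- N y (DM(y)(w) (N y v))\<close>, which is built from \<open>N\<close> and the first
  derivatives of \<open>M\<close>. So \<open>N\<close> is as often differentiable as \<open>M\<close>, by induction on \<open>k\<close>.\<close>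

lemma Ck_on_inverse_family:
  fixes M N :: "'a::real_normed_vector \<Rightarrow> 'b::euclidean_space \<Rightarrow> 'b"
  assumes "open S"
    and lin: "\<And>y. y \<in> S \<Longrightarrow> linear (M y)"
    and MN: "\<And>y x. y \<in> S \<Longrightarrow> M y (N y x) = x"
    and NM: "\<And>y x. y \<in> S \<Longrightarrow> N y (M y x) = x"
    and "\<And>b. Ck_on k S (\<lambda>y. M y b)"
  shows "Ck_on k S (\<lambda>y. N y v)"
  using assms(5)
proof (induction k arbitrary: v)
  case 0
  then have "isCont (\<lambda>y. N y v) y0" if "y0 \<in> S" for y0
    using inverse_family_continuous[OF assms(1) that lin _ MN NM] by auto
  then show ?case by (simp add: continuous_at_imp_continuous_on)
next
  case (Suc k)
  note low = Suc.prems[THEN Ck_on_Suc_imp]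
  have linN: "linear (N y)" if "y \<in> S" for y
  proof (rule linearI)
    show "N y (a + b) = N y a + N y b" for a b
      using NM[OF that, of "N y a + N y b"] by (simp add: linear_add[OF lin[OF that]] MN[OF that])
    show "N y (r *\<^sub>R a) = r *\<^sub>R N y a" for r a
      using NM[OF that, of "r *\<^sub>R N y a"] by (simp add: linear_scale[OF lin[OF that]] MN[OF that])
  qed
  have N_expand: "N y x = (\<Sum>b\<in>Basis. (x \<bullet> b) *\<^sub>R N y b)" if "y \<in> S" for x y
    by (rule linear_euclidean_expansion[OF linN[OF that]])
  have cont: "isCont (\<lambda>y. N y b) y0" if "y0 \<in> S" for y0 b
    using Suc.IH[OF low, THEN Ck_on_mono[OF le0], of b] assms(1) that
    by (simp add: continuous_on_eq_continuous_at)
  \<comment> \<open>\<open>Md y x w\<close> is the derivative of \<open>y \<mapsto> M y x\<close> in direction \<open>w\<close>, expanded in \<open>x\<close>, which will depend on \<open>y\<close>.\<close>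
  define Md where "Md = (\<lambda>y x w. \<Sum>a\<in>(Basis::'b set). (x \<bullet> a) *\<^sub>R frechet_derivative (\<lambda>y. M y a) (at y) w)"
  show ?case
  proof (rule Ck_on_SucI[OF assms(1)])
    show "((\<lambda>y. N y v) has_derivative (\<lambda>w. \<Sum>b\<in>Basis. - (Md y0 (N y0 v) w \<bullet> b) *\<^sub>R N y0 b)) (at y0)"
      if y0: "y0 \<in> S" for y0
    proof -
      define u where "u = N y0 v"
      have M_expand: "M y u = (\<Sum>a\<in>Basis. (u \<bullet> a) *\<^sub>R M y a)" if "y \<in> S" for y
        by (rule linear_euclidean_expansion[OF lin[OF that]])
      have "((\<lambda>y. \<Sum>a\<in>Basis. (u \<bullet> a) *\<^sub>R M y a) has_derivative Md y0 u) (at y0)"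
        unfolding Md_def
        using Ck_on_has_derivative[OF Suc.prems y0]
        by (intro has_derivative_sum has_derivative_scaleR_right) auto
      then have Mu: "((\<lambda>y. M y u) has_derivative Md y0 u) (at y0)"
        by (rule has_derivative_transform_within_open[OF _ assms(1) y0]) (simp add: M_expand)
      \<comment> \<open>Each coefficient of \<open>M y u - M y0 u\<close> vanishes at \<open>y0\<close>, so the product rule asks only for continuity of \<open>N\<close>.\<close>
      have "((\<lambda>y. N y0 v + (\<Sum>b\<in>Basis. - ((M y u - M y0 u) \<bullet> b) *\<^sub>R N y b)) has_derivative
          (\<lambda>w. 0 + (\<Sum>b\<in>Basis. - (Md y0 u w \<bullet> b) *\<^sub>R N y0 b))) (at y0)"
      proof (intro has_derivative_add has_derivative_const has_derivative_sum)
        fix b :: 'b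
        have "((\<lambda>y. - ((M y u - M y0 u) \<bullet> b)) has_derivative (\<lambda>w. - ((Md y0 u w - 0) \<bullet> b))) (at y0)"
          by (intro has_derivative_minus has_derivative_inner_left has_derivative_diff Mu has_derivative_const)
        then show "((\<lambda>y. - ((M y u - M y0 u) \<bullet> b) *\<^sub>R N y b) has_derivative
            (\<lambda>w. - (Md y0 u w \<bullet> b) *\<^sub>R N y0 b)) (at y0)"
          by (intro has_derivative_scaleR_vanishing cont[OF y0]) auto
      qed
      then have "((\<lambda>y. N y v) has_derivative (\<lambda>w. 0 + (\<Sum>b\<in>Basis. - (Md y0 u w \<bullet> b) *\<^sub>R N y0 b))) (at y0)"
      proof (rule has_derivative_transform_within_open[OF _ assms(1) y0])
        fix y assume y: "y \<in> S"
        have "N y v = N y0 v - N y (M y u - M y0 u)"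
          using y y0 MN NM linN by (simp add: u_def linear_diff)
        then show "N y0 v + (\<Sum>b\<in>Basis. - ((M y u - M y0 u) \<bullet> b) *\<^sub>R N y b) = N y v"
          using N_expand[OF y, of "M y u - M y0 u"] by (simp add: sum_negf)
      qed
      then show ?thesis by (simp add: u_def)
    qed
    show "Ck_on k S (\<lambda>y. \<Sum>b\<in>Basis. - (Md y (N y v) w \<bullet> b) *\<^sub>R N y b)" for w
    proof (intro Ck_on_sum[OF assms(1)] Ck_on_scaleR[OF assms(1)] Suc.IH[OF low])
      fix b :: 'b
      have "Ck_on k S (\<lambda>y. Md y (N y v) w)"
        unfolding Md_def using Suc.prems
        by (intro Ck_on_sum[OF assms(1)] Ck_on_scaleR[OF assms(1)]
            Ck_on_linear_compose[OF assms(1) bounded_linear_inner_left] Suc.IH[OF low]) auto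
      moreover have "bounded_linear (\<lambda>x::'b. - (x \<bullet> b))"
        by (intro bounded_linear_minus bounded_linear_inner_left)
      ultimately show "Ck_on k S (\<lambda>y. - (Md y (N y v) w \<bullet> b))"
        by (intro Ck_on_linear_compose[OF assms(1), of "\<lambda>x. - (x \<bullet> b)"])
    qed
  qed
qed

text \<open>Bootstrapping: \<open>h' y\<close> is the inverse of \<open>Df(h y)\<close>. If \<open>h\<close> is \<open>C\<^sup>k\<close>, then so is \<open>y \<mapsto> Df(h y)\<close>, hence
  its inverse \<open>h'\<close>, and therefore \<open>h\<close> is \<open>C\<^bsup>k+1\<^esup>\<close>.\<close>

lemma smooth_on_local_inverse:
  fixes f :: "'a::euclidean_space \<Rightarrow> 'a"
  assumes "open T" "smooth_on S f" "h ` T \<subseteq> S"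
    and der: "\<And>y. y \<in> T \<Longrightarrow> (h has_derivative h' y) (at y)"
    and fh: "\<And>y x. y \<in> T \<Longrightarrow> frechet_derivative f (at (h y)) (h' y x) = x"
    and hf: "\<And>y x. y \<in> T \<Longrightarrow> h' y (frechet_derivative f (at (h y)) x) = x"
  shows "smooth_on T h"
proof -
  have "Ck_on k T h" for k
  proof (induction k)
    case 0
    then show ?case
      using der by (auto intro!: continuous_at_imp_continuous_on has_derivative_continuous)
  next
    case (Suc k)
    show ?case
    proof (rule Ck_on_SucI[OF assms(1) der])
      have k: "Ck_on k S (\<lambda>x. frechet_derivative f (at x) b)" for b
        using smooth_on_frechet_derivative[OF assms(2)] by (simp add: smooth_on_def)
      have kh: "Ck_on k T (\<lambda>y. frechet_derivative f (at (h y)) b)" for b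
        by (rule Ck_on_compose[OF assms(1,3) Suc.IH k])
      have lin: "linear (frechet_derivative f (at (h y)))" if "y \<in> T" for y
        using smooth_on_has_derivative[OF assms(2)] that assms(3)
        by (blast intro: has_derivative_linear)
      show "Ck_on k T (\<lambda>y. h' y v)" for v
        by (rule Ck_on_inverse_family[OF assms(1) lin fh hf kh])
    qed
  qed
  then show ?thesis by (simp add: smooth_on_def)
qed

lemma frechet_derivative_left_inverse:
  assumes "open S" "x \<in> S" "f differentiable (at x)" "h differentiable (at (f x))"
    and "\<And>y. y \<in> S \<Longrightarrow> h (f y) = y"
  shows "frechet_derivative h (at (f x)) (frechet_derivative f (at x) v) = v"
proof -
  have "((\<lambda>y. h (f y)) has_derivative
      (\<lambda>v. frechet_derivative h (at (f x)) (frechet_derivative f (at x) v))) (at x)"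
    by (rule has_derivative_compose[OF assms(3,4)[unfolded frechet_derivative_works]])
  then have "((\<lambda>y. y) has_derivative
      (\<lambda>v. frechet_derivative h (at (f x)) (frechet_derivative f (at x) v))) (at x)"
    by (rule has_derivative_transform_within_open[OF _ assms(1,2,5)])
  then show ?thesis
    by (metis has_derivative_ident has_derivative_unique)
qed

text \<open>The inverse function theorem for continuously differentiable maps yields a differentiable local
  inverse, and bootstrapping makes it smooth.\<close>

theorem smooth_inverse_function_theorem:
  fixes f :: "'a::euclidean_space \<Rightarrow> 'a"
  assumes "open S" "smooth_on S f" "x0 \<in> S" "inj (frechet_derivative f (at x0))"
  obtains S' T h where "open S'" "S' \<subseteq> S" "x0 \<in> S'" "open T" "f ` S' = T" "h ` T = S'"
    "\<And>x. x \<in> S' \<Longrightarrow> h (f x) = x" "\<And>y. y \<in> T \<Longrightarrow> f (h y) = y" "smooth_on T h"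
proof -
  define f' where "f' = (\<lambda>x. Blinfun (frechet_derivative f (at x)))"
  have der: "(f has_derivative frechet_derivative f (at x)) (at x)" if "x \<in> S" for x
    using smooth_on_has_derivative[OF assms(2) that] .
  have f': "blinfun_apply (f' x) = frechet_derivative f (at x)" if "x \<in> S" for x
    unfolding f'_def using has_derivative_bounded_linear[OF der[OF that]]
    by (rule bounded_linear_Blinfun_apply)
  have cont: "continuous_on S f'"
  proof (rule continuous_on_blinfun_componentwise)
    fix b :: 'a
    have "continuous_on S (\<lambda>x. frechet_derivative f (at x) b)"
      using smooth_on_frechet_derivative[OF assms(2), of b] unfolding smooth_on_def
      by (metis Ck_on.simps(1))
    then show "continuous_on S (\<lambda>x. blinfun_apply (f' x) b)"
      using f' by (simp cong: continuous_on_cong)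
  qed
  obtain k where k: "linear k" "k \<circ> frechet_derivative f (at x0) = id"
    using linear_injective_left_inverse[OF has_derivative_linear[OF der[OF assms(3)]] assms(4)] by blast
  have "Blinfun k o\<^sub>L f' x0 = id_blinfun"
    using k f'[OF assms(3)]
    by (intro blinfun_eqI) (simp add: bounded_linear_Blinfun_apply linear_conv_bounded_linear pointfree_idE)
  then obtain S' T h h' where *: "open S'" "S' \<subseteq> S" "x0 \<in> S'" "open T" "homeomorphism S' T f h"
    "\<And>y. y \<in> T \<Longrightarrow> (h has_derivative h' y) (at y)"
    "\<And>y. y \<in> T \<Longrightarrow> h' y = inv (blinfun_apply (f' (h y)))"
    "\<And>y. y \<in> T \<Longrightarrow> bij (blinfun_apply (f' (h y)))"
    using inverse_function_theorem[OF assms(1) _ cont assms(3)] der f' by (metis (no_types, lifting))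
  have img: "f ` S' = T" "h ` T = S'" and inv: "\<And>x. x \<in> S' \<Longrightarrow> h (f x) = x" "\<And>y. y \<in> T \<Longrightarrow> f (h y) = y"
    using *(5) by (auto simp: homeomorphism_def)
  have "smooth_on T h"
  proof (rule smooth_on_local_inverse[OF *(4) assms(2) _ *(6)])
    show "h ` T \<subseteq> S" using img *(2) by blast
    fix y x assume y: "y \<in> T"
    then have "h y \<in> S" using img *(2) by blast
    then have eq: "blinfun_apply (f' (h y)) = frechet_derivative f (at (h y))" by (rule f')
    show "frechet_derivative f (at (h y)) (h' y x) = x"
      using *(7,8)[OF y] eq by (simp add: bij_is_surj surj_f_inv_f)
    show "h' y (frechet_derivative f (at (h y)) x) = x"
      using *(7,8)[OF y] eq by (simp add: bij_is_inj inv_f_f)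
  qed
  show thesis by (rule that[OF *(1-4) img inv \<open>smooth_on T h\<close>])
qed

section \<open>Linear coordinates along and across the leaves\<close>

lemma leaf_join [simp]: "leaf_coords (join_coords x y) = x"
  and transverse_join [simp]: "transverse_coords (join_coords x y) = y"
  by (simp_all add: leaf_coords_def transverse_coords_def join_coords_def vec_eq_iff)

lemma join_leaf_transverse [simp]: "join_coords (leaf_coords w) (transverse_coords w) = w"
  by (auto simp: leaf_coords_def transverse_coords_def join_coords_def vec_eq_iff split: sum.split)

lemma join_coords_add: "join_coords (x + x') (y + y') = join_coords x y + join_coords x' y'"
  by (auto simp: join_coords_def vec_eq_iff split: sum.split)

lemma join_coords_scaleR: "join_coords (r *\<^sub>R x) (r *\<^sub>R y) = r *\<^sub>R join_coords x y"
  by (auto simp: join_coords_def vec_eq_iff split: sum.split)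

lemma join_coords_0 [simp]: "join_coords 0 0 = 0"
  by (auto simp: join_coords_def vec_eq_iff split: sum.split)

lemma bounded_linear_leaf_coords: "bounded_linear leaf_coords"
  by (rule linear_conv_bounded_linear[THEN iffD1])
    (auto intro!: linearI simp: leaf_coords_def vec_eq_iff)

lemma bounded_linear_transverse_coords: "bounded_linear transverse_coords"
  by (rule linear_conv_bounded_linear[THEN iffD1])
    (auto intro!: linearI simp: transverse_coords_def vec_eq_iff)

lemma bounded_linear_join_leaf: "bounded_linear (\<lambda>x. join_coords x 0)"
  by (rule linear_conv_bounded_linear[THEN iffD1])
    (auto intro!: linearI simp: join_coords_add[symmetric] join_coords_scaleR[symmetric])

lemma bounded_linear_join_transverse: "bounded_linear (\<lambda>y. join_coords 0 y)"
  by (rule linear_conv_bounded_linear[THEN iffD1])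
    (auto intro!: linearI simp: join_coords_add[symmetric] join_coords_scaleR[symmetric])

lemma join_coords_split: "join_coords x y = join_coords x 0 + join_coords 0 y"
  by (simp flip: join_coords_add)

lemma plaque_inclusion_has_derivative:
  "((\<lambda>x. join_coords x y) has_derivative (\<lambda>a. join_coords a 0)) (at x)"
proof -
  have "((\<lambda>x. join_coords x 0 + join_coords 0 y) has_derivative (\<lambda>a. join_coords a 0 + 0)) (at x)"
    by (intro has_derivative_add has_derivative_const
        bounded_linear.has_derivative[OF bounded_linear_join_leaf has_derivative_ident])
  then show ?thesis by (simp flip: join_coords_split)
qed

lemma smooth_plaque_inclusion: "smooth_on UNIV (\<lambda>x. join_coords x y)"
proof -
  have "smooth_on UNIV (\<lambda>x. join_coords x 0 + join_coords 0 y)"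
    by (intro smooth_on_add smooth_on_const smooth_on_bounded_linear[OF bounded_linear_join_leaf]) simp
  then show ?thesis by (simp flip: join_coords_split)
qed

section \<open>Foliated charts and plaques\<close>

lemma open_polydisc: "open (polydisc c r)"
proof -
  have "polydisc c r = (\<Inter>k. {w. dist (c $ k) (w $ k) < r $ k})"
    by (auto simp: polydisc_def)
  also have "open \<dots>"
    by (intro open_INT finite ballI open_Collect_less continuous_intros)
  finally show ?thesis .
qed

text \<open>The subspace of directions along the plaque of the chart \<open>\<phi>\<close> through \<open>z\<close>. It will turn out to be
  the tangent space of the leaf, for every chart of the foliation.\<close>

definition plaque_tangent_space ::
  "(complex^'n \<Rightarrow> complex^('d::finite + 'q::finite)) \<Rightarrow> complex^'n \<Rightarrow> (complex^'n) set" where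
  "plaque_tangent_space \<phi> z = {v. transverse_coords (frechet_derivative \<phi> (at z) v) = 0}"

locale foliated_coordinates =
  fixes V :: "(complex^'n::finite) set" and \<phi> :: "complex^'n \<Rightarrow> complex^('d::finite + 'q::finite)"
  assumes chart: "foliated_chart (V, \<phi>)"
begin

abbreviation \<psi> where "\<psi> \<equiv> inv_into V \<phi>"

abbreviation D\<phi> where "D\<phi> z \<equiv> frechet_derivative \<phi> (at z)"

abbreviation D\<psi> where "D\<psi> w \<equiv> frechet_derivative \<psi> (at w)"

lemma open_domain: "open V" and open_image: "open (\<phi> ` V)"
  and smooth_chart: "smooth_on V \<phi>" and smooth_chart_inverse: "smooth_on (\<phi> ` V) \<psi>"
  using chart by (auto simp: foliated_chart_def holomorphic_map_def open_polydisc)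

lemma chart_left_inverse: "z \<in> V \<Longrightarrow> \<psi> (\<phi> z) = z"
  using chart by (simp add: foliated_chart_def)

lemma chart_right_inverse: "w \<in> \<phi> ` V \<Longrightarrow> \<phi> (\<psi> w) = w"
  by (rule f_inv_into_f)

lemma chart_inverse_in_domain: "w \<in> \<phi> ` V \<Longrightarrow> \<psi> w \<in> V"
  by (rule inv_into_into)

lemma chart_has_derivative: "z \<in> V \<Longrightarrow> (\<phi> has_derivative D\<phi> z) (at z)"
  by (rule smooth_on_has_derivative[OF smooth_chart])

lemma chart_inverse_has_derivative: "w \<in> \<phi> ` V \<Longrightarrow> (\<psi> has_derivative D\<psi> w) (at w)"
  by (rule smooth_on_has_derivative[OF smooth_chart_inverse])

lemma D\<psi>_D\<phi>: "z \<in> V \<Longrightarrow> D\<psi> (\<phi> z) (D\<phi> z v) = v"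
  using chart_has_derivative chart_inverse_has_derivative chart_left_inverse
  by (intro frechet_derivative_left_inverse[OF open_domain]) (auto simp: differentiable_def)

lemma D\<phi>_D\<psi>:
  assumes "z \<in> V"
  shows "D\<phi> z (D\<psi> (\<phi> z) v) = v"
proof -
  have "D\<phi> (\<psi> (\<phi> z)) (D\<psi> (\<phi> z) v) = v"
  proof (rule frechet_derivative_left_inverse[OF open_image])
    show "\<phi> z \<in> \<phi> ` V" using assms by simp
    show "\<psi> differentiable at (\<phi> z)" "\<phi> differentiable at (\<psi> (\<phi> z))"
      using assms chart_has_derivative chart_inverse_has_derivative chart_left_inverse
      by (auto simp: differentiable_def)
  qed (rule chart_right_inverse)
  then show ?thesis using assms chart_left_inverse by simp
qed

lemma linear_D\<phi>: "z \<in> V \<Longrightarrow> linear (D\<phi> z)"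
  using chart_has_derivative has_derivative_linear by blast

lemma linear_D\<psi>: "w \<in> \<phi> ` V \<Longrightarrow> linear (D\<psi> w)"
  using chart_inverse_has_derivative has_derivative_linear by blast

lemma open_plaque_domain: "open (plaque_domain (V, \<phi>) z)"
proof -
  have "open ((\<lambda>x. join_coords x (transverse_coords (\<phi> z))) -` (\<phi> ` V))"
    by (intro open_vimage open_image continuous_at_imp_continuous_on ballI
        has_derivative_continuous[OF plaque_inclusion_has_derivative])
  then show ?thesis by (simp add: plaque_domain_def vimage_def)
qed

lemma plaque_param_has_derivative:
  assumes "x \<in> plaque_domain (V, \<phi>) z"
  shows "(plaque_param (V, \<phi>) z has_derivative
    (\<lambda>a. D\<psi> (join_coords x (transverse_coords (\<phi> z))) (join_coords a 0))) (at x)"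
  using has_derivative_compose[OF plaque_inclusion_has_derivative chart_inverse_has_derivative] assms
  by (simp add: plaque_domain_def plaque_param_def)

lemma smooth_plaque_param: "smooth_on (plaque_domain (V, \<phi>) z) (plaque_param (V, \<phi>) z)"
proof -
  have "smooth_on (plaque_domain (V, \<phi>) z) (\<lambda>x. \<psi> (join_coords x (transverse_coords (\<phi> z))))"
    by (rule smooth_on_compose[OF open_plaque_domain _
          smooth_on_subset[OF smooth_plaque_inclusion] smooth_chart_inverse])
      (auto simp: plaque_domain_def)
  then show ?thesis by (simp add: plaque_param_def)
qed

lemma plaque_param_in_domain: "x \<in> plaque_domain (V, \<phi>) z \<Longrightarrow> plaque_param (V, \<phi>) z x \<in> V"
  by (auto simp: plaque_domain_def plaque_param_def inv_into_into)

lemma centre_in_plaque_domain: "z \<in> V \<Longrightarrow> leaf_coords (\<phi> z) \<in> plaque_domain (V, \<phi>) z"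
  by (simp add: plaque_domain_def)

lemma plaque_tangent_space_eq:
  assumes "z \<in> V"
  shows "plaque_tangent_space \<phi> z = range (\<lambda>a. D\<psi> (\<phi> z) (join_coords a 0))"
proof (intro set_eqI iffI)
  fix v assume "v \<in> plaque_tangent_space \<phi> z"
  then have "join_coords (leaf_coords (D\<phi> z v)) 0 = D\<phi> z v"
    unfolding plaque_tangent_space_def by (metis (lifting) join_leaf_transverse mem_Collect_eq)
  then show "v \<in> range (\<lambda>a. D\<psi> (\<phi> z) (join_coords a 0))"
    using D\<psi>_D\<phi>[OF assms] by (metis rangeI)
next
  fix v assume "v \<in> range (\<lambda>a. D\<psi> (\<phi> z) (join_coords a 0))"
  then show "v \<in> plaque_tangent_space \<phi> z"
    using D\<phi>_D\<psi>[OF assms] by (auto simp: plaque_tangent_space_def)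
qed

lemma range_plaque_param_derivative:
  assumes "z \<in> V"
  shows "range (frechet_derivative (plaque_param (V, \<phi>) z) (at (leaf_coords (\<phi> z)))) = plaque_tangent_space \<phi> z"
  using frechet_derivative_at[OF plaque_param_has_derivative[OF centre_in_plaque_domain[OF assms]], symmetric]
  by (simp add: plaque_tangent_space_eq[OF assms])

end

text \<open>Near \<open>z\<close> the plaque of the first chart lies in one plaque of the second chart, by compatibility. So
  the transverse coordinates of the second chart are constant along it, and their derivatives along
  it vanish.\<close>

lemma plaque_tangent_space_compatible:
  fixes \<phi> \<phi>' :: "complex^'n::finite \<Rightarrow> complex^('d::finite + 'q::finite)"
  assumes "foliated_chart (V, \<phi>)" "foliated_chart (V', \<phi>')" "compatible (V, \<phi>) (V', \<phi>')"
    and z: "z \<in> V" "z \<in> V'"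
  shows "plaque_tangent_space \<phi> z \<subseteq> plaque_tangent_space \<phi>' z"
proof -
  interpret A: foliated_coordinates V \<phi> by unfold_locales fact
  interpret B: foliated_coordinates V' \<phi>' by unfold_locales fact
  have "\<exists>W. open W \<and> z \<in> W \<and> W \<subseteq> V \<inter> V' \<and>
      (\<forall>u\<in>W. \<forall>w\<in>W. transverse_coords (\<phi> u) = transverse_coords (\<phi> w) \<longleftrightarrow>
                    transverse_coords (\<phi>' u) = transverse_coords (\<phi>' w))"
    using assms(3) z by (simp add: compatible_def)
  then obtain W where W: "open W" "z \<in> W" "W \<subseteq> V \<inter> V'"
    and plaques: "\<And>u w. u \<in> W \<Longrightarrow> w \<in> W \<Longrightarrow> transverse_coords (\<phi> u) = transverse_coords (\<phi> w) \<Longrightarrow>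
      transverse_coords (\<phi>' u) = transverse_coords (\<phi>' w)"
    by blast
  let ?p = "plaque_param (V, \<phi>) z" and ?x = "leaf_coords (\<phi> z)"
  have p: "(?p has_derivative (\<lambda>a. A.D\<psi> (\<phi> z) (join_coords a 0))) (at ?x)"
    using A.plaque_param_has_derivative[OF A.centre_in_plaque_domain[OF z(1)]] by simp
  have px: "?p ?x = z" by (simp add: plaque_param_def A.chart_left_inverse z)
  have "(?p \<longlongrightarrow> ?p ?x) (nhds ?x)"
    using has_derivative_continuous[OF p] by (simp add: isCont_def tendsto_at_iff_tendsto_nhds)
  then have "\<forall>\<^sub>F x in nhds ?x. ?p x \<in> W \<and> x \<in> plaque_domain (V, \<phi>) z"
    using W px A.open_plaque_domain A.centre_in_plaque_domain[OF z(1)]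
    by (intro eventually_conj) (auto simp: tendsto_def eventually_nhds_in_open)
  then obtain N where N: "open N" "?x \<in> N" "\<And>x. x \<in> N \<Longrightarrow> ?p x \<in> W \<and> x \<in> plaque_domain (V, \<phi>) z"
    unfolding eventually_nhds by blast
  have const: "transverse_coords (\<phi>' (?p x)) = transverse_coords (\<phi>' z)" if "x \<in> N" for x
    using N(3)[OF that] W(2) A.chart_right_inverse
    by (intro plaques) (auto simp: plaque_param_def plaque_domain_def)
  have "((\<lambda>x. transverse_coords (\<phi>' (?p x))) has_derivative
      (\<lambda>a. transverse_coords (B.D\<phi> z (A.D\<psi> (\<phi> z) (join_coords a 0))))) (at ?x)"
    using B.chart_has_derivative[OF z(2)] px
    by (intro bounded_linear.has_derivative[OF bounded_linear_transverse_coords]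
        has_derivative_compose[OF p]) simp
  then have "((\<lambda>x. transverse_coords (\<phi>' z)) has_derivative
      (\<lambda>a. transverse_coords (B.D\<phi> z (A.D\<psi> (\<phi> z) (join_coords a 0))))) (at ?x)"
    by (rule has_derivative_transform_within_open[OF _ N(1,2) const])
  then have "(\<lambda>a. transverse_coords (B.D\<phi> z (A.D\<psi> (\<phi> z) (join_coords a 0)))) = (\<lambda>a. 0)"
    using has_derivative_const has_derivative_unique by blast
  then show ?thesis
    unfolding A.plaque_tangent_space_eq[OF z(1)]
    by (auto simp: plaque_tangent_space_def dest: fun_cong)
qed

lemma leaf_tangent_space_eq_plaque:
  assumes "regular_holomorphic_foliation W \<F>" "(V, \<phi>) \<in> \<F>" "z \<in> V"
  shows "leaf_tangent_space \<F> z = plaque_tangent_space \<phi> z"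
proof -
  have charts: "foliated_chart c" "compatible c c'" if "c \<in> \<F>" "c' \<in> \<F>" for c c'
    using assms(1) that by (auto simp: regular_holomorphic_foliation_def)
  have sub: "plaque_tangent_space \<phi>' z \<subseteq> plaque_tangent_space \<phi>'' z"
    if "(V', \<phi>') \<in> \<F>" "(V'', \<phi>'') \<in> \<F>" "z \<in> V'" "z \<in> V''" for V' V'' \<phi>' \<phi>''
    by (rule plaque_tangent_space_compatible[OF charts(1) charts(1) charts(2)])
      (fact that)+
  have range: "range (frechet_derivative (plaque_param (V', \<phi>') z) (at (leaf_coords (\<phi>' z))))
      = plaque_tangent_space \<phi>' z" if "(V', \<phi>') \<in> \<F>" "z \<in> V'" for V' \<phi>'
    by (rule foliated_coordinates.range_plaque_param_derivative[OF foliated_coordinates.intro[OF charts(1)]])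
      (fact that)+
  show ?thesis
  proof (intro set_eqI iffI)
    fix v assume "v \<in> leaf_tangent_space \<F> z"
    then obtain V' \<phi>' where "(V', \<phi>') \<in> \<F>" "z \<in> V'"
      "v \<in> range (frechet_derivative (plaque_param (V', \<phi>') z) (at (leaf_coords (\<phi>' z))))"
      unfolding leaf_tangent_space_def by fastforce
    then show "v \<in> plaque_tangent_space \<phi> z"
      using range sub[OF _ assms(2) _ assms(3)] by blast
  next
    fix v assume "v \<in> plaque_tangent_space \<phi> z"
    then have "v \<in> range (frechet_derivative (plaque_param (V, \<phi>) z) (at (leaf_coords (\<phi> z))))"
      using range[OF assms(2,3)] by blast
    then show "v \<in> leaf_tangent_space \<F> z"
      unfolding leaf_tangent_space_def using assms(2,3) by (intro CollectI bexI[of _ "(V, \<phi>)"]) simp_all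
  qed
qed

section \<open>The polar equations of a function in a chart\<close>

locale function_in_chart = foliated_coordinates V \<phi>
  for V :: "(complex^'n::finite) set" and \<phi> :: "complex^'n \<Rightarrow> complex^('d::finite + 'q::finite)" +
  fixes g :: "complex^'n \<Rightarrow> real"
  assumes smooth_function: "smooth_on V g"
begin

abbreviation P where "P \<equiv> polar_equations (V, \<phi>) g"

text \<open>The map called \<open>A\<close> in the introduction: the derivative of the polar equations in the directions
  of the leaf.\<close>

definition leafwise_derivative where
  "leafwise_derivative z v = frechet_derivative P (at (\<phi> z)) (join_coords v 0)"

lemma smooth_function_in_coordinates: "smooth_on (\<phi> ` V) (g \<circ> \<psi>)"
proof -
  have "smooth_on (\<phi> ` V) (\<lambda>w. g (\<psi> w))"
    using chart_inverse_in_domain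
    by (intro smooth_on_compose[OF open_image _ smooth_chart_inverse smooth_function]) auto
  then show ?thesis by (simp add: comp_def)
qed

text \<open>The polar equations form the leafwise gradient: both sides are linear in \<open>v\<close>, and on the vectors
  \<open>e\<^sub>j\<close> and \<open>\<i> e\<^sub>j\<close> of the standard real basis they agree by definition of the polar equations.\<close>

lemma polar_equations_inner:
  assumes "w \<in> \<phi> ` V"
  shows "P w \<bullet> v = frechet_derivative (g \<circ> \<psi>) (at w) (join_coords v 0)"
proof -
  let ?F = "frechet_derivative (g \<circ> \<psi>) (at w)"
  have "linear ?F"
    using smooth_on_has_derivative[OF smooth_function_in_coordinates assms] by (rule has_derivative_linear)
  then have "linear (\<lambda>v. ?F (join_coords v 0))"
    using linear_compose[OF bounded_linear.linear[OF bounded_linear_join_leaf]] by (simp add: comp_def)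
  moreover have "linear (\<lambda>v. P w \<bullet> v)"
    by (rule bounded_linear.linear) (rule bounded_linear_inner_right)
  moreover have "P w \<bullet> b = ?F (join_coords b 0)" if basis: "b \<in> Basis" for b
  proof -
    obtain j u where b: "b = axis j u" "u = 1 \<or> u = \<i>"
      using basis unfolding Basis_vec_def Basis_complex_def by blast
    have "join_coords (axis j u) 0 = (axis (Inl j) u :: complex^('d + 'q))"
      by (auto simp: join_coords_def axis_def vec_eq_iff split: sum.split)
    then show ?thesis using b(2)
      by (auto simp: b(1) inner_axis polar_equations_def inner_complex_def)
  qed
  ultimately have "(\<lambda>v. P w \<bullet> v) = (\<lambda>v. ?F (join_coords v 0))"
    by (intro linear_eq_stdbasis)
  then show ?thesis by meson
qed

lemma smooth_polar_equations: "smooth_on (\<phi> ` V) P"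
proof -
  have "smooth_on (\<phi> ` V) (\<lambda>w. \<Sum>b\<in>Basis. frechet_derivative (g \<circ> \<psi>) (at w) (join_coords b 0) *\<^sub>R b)"
    by (intro smooth_on_sum smooth_on_scaleR open_image smooth_on_const
        smooth_on_frechet_derivative smooth_function_in_coordinates)
  then show ?thesis
  proof (rule smooth_on_cong[OF open_image])
    fix w assume "w \<in> \<phi> ` V"
    then show "(\<Sum>b\<in>Basis. frechet_derivative (g \<circ> \<psi>) (at w) (join_coords b 0) *\<^sub>R b) = P w"
      by (simp flip: polar_equations_inner add: euclidean_representation)
  qed
qed

lemma polar_equations_has_derivative:
  "w \<in> \<phi> ` V \<Longrightarrow> (P has_derivative frechet_derivative P (at w)) (at w)"
  by (rule smooth_on_has_derivative[OF smooth_polar_equations])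

lemma linear_leafwise_derivative:
  assumes "z \<in> V"
  shows "linear (leafwise_derivative z)"
proof -
  have "linear (frechet_derivative P (at (\<phi> z)))"
    using polar_equations_has_derivative assms by (blast intro: has_derivative_linear)
  then show ?thesis
    using linear_compose[OF bounded_linear.linear[OF bounded_linear_join_leaf]]
    unfolding leafwise_derivative_def by (simp add: comp_def)
qed

lemma function_on_plaque_derivative:
  assumes "x \<in> plaque_domain (V, \<phi>) z"
  shows "frechet_derivative (g \<circ> plaque_param (V, \<phi>) z) (at x) v
    = P (join_coords x (transverse_coords (\<phi> z))) \<bullet> v"
proof -
  let ?w = "join_coords x (transverse_coords (\<phi> z))"
  have w: "?w \<in> \<phi> ` V" using assms by (simp add: plaque_domain_def)
  have "((\<lambda>x. (g \<circ> \<psi>) (join_coords x (transverse_coords (\<phi> z)))) has_derivative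
      (\<lambda>v. frechet_derivative (g \<circ> \<psi>) (at ?w) (join_coords v 0))) (at x)"
    by (rule has_derivative_compose[OF plaque_inclusion_has_derivative
          smooth_on_has_derivative[OF smooth_function_in_coordinates w]])
  then have "(g \<circ> plaque_param (V, \<phi>) z has_derivative (\<lambda>v. P ?w \<bullet> v)) (at x)"
    by (simp add: comp_def plaque_param_def polar_equations_inner[OF w])
  then show ?thesis by (metis frechet_derivative_at)
qed

text \<open>The first derivative of the function on the plaque in direction \<open>v\<close> is \<open>P \<bullet> v\<close>; a second
  differentiation in direction \<open>w\<close> differentiates \<open>P\<close> along the leaf.\<close>

lemma function_on_plaque_hessian:
  assumes "x \<in> plaque_domain (V, \<phi>) z" "z' = plaque_param (V, \<phi>) z x"
  shows "hessian (g \<circ> plaque_param (V, \<phi>) z) x v w = leafwise_derivative z' w \<bullet> v"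
proof -
  let ?y = "transverse_coords (\<phi> z)"
  have w: "join_coords x ?y \<in> \<phi> ` V" using assms by (simp add: plaque_domain_def)
  have z': "\<phi> z' = join_coords x ?y"
    using assms chart_right_inverse w by (simp add: plaque_param_def)
  have "((\<lambda>x. P (join_coords x ?y)) has_derivative
      (\<lambda>a. frechet_derivative P (at (join_coords x ?y)) (join_coords a 0))) (at x)"
    by (rule has_derivative_compose[OF plaque_inclusion_has_derivative polar_equations_has_derivative[OF w]])
  then have "((\<lambda>x. P (join_coords x ?y) \<bullet> v) has_derivative (\<lambda>a. leafwise_derivative z' a \<bullet> v)) (at x)"
    unfolding leafwise_derivative_def z' by (rule has_derivative_inner_left)
  then have "((\<lambda>x. frechet_derivative (g \<circ> plaque_param (V, \<phi>) z) (at x) v) has_derivative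
      (\<lambda>a. leafwise_derivative z' a \<bullet> v)) (at x)"
    by (rule has_derivative_transform_within_open[OF _ open_plaque_domain assms(1)])
      (simp add: function_on_plaque_derivative)
  then show ?thesis unfolding hessian_def by (metis frechet_derivative_at)
qed

lemma critical_point_on_plaque_iff:
  assumes "x \<in> plaque_domain (V, \<phi>) z"
  shows "critical_point (g \<circ> plaque_param (V, \<phi>) z) x \<longleftrightarrow> P (\<phi> (plaque_param (V, \<phi>) z x)) = 0"
proof -
  have "\<phi> (plaque_param (V, \<phi>) z x) = join_coords x (transverse_coords (\<phi> z))"
    using assms chart_right_inverse by (simp add: plaque_param_def plaque_domain_def)
  moreover have "(\<forall>v. u \<bullet> v = 0) \<longleftrightarrow> u = 0" for u :: "complex^'d"
    by (metis inner_eq_zero_iff inner_zero_left)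
  ultimately show ?thesis
    by (simp add: critical_point_def function_on_plaque_derivative[OF assms])
qed

lemma nondegenerate_on_plaque_iff:
  assumes "x \<in> plaque_domain (V, \<phi>) z"
  shows "nondegenerate (g \<circ> plaque_param (V, \<phi>) z) x
    \<longleftrightarrow> surj (leafwise_derivative (plaque_param (V, \<phi>) z x))"
  using linear_surj_iff_no_orthogonal_vector[OF linear_leafwise_derivative[OF plaque_param_in_domain[OF assms]]]
  by (simp add: nondegenerate_def function_on_plaque_hessian[OF assms refl])

lemma smooth_function_on_plaque: "smooth_on (plaque_domain (V, \<phi>) z) (g \<circ> plaque_param (V, \<phi>) z)"
  using smooth_on_compose[OF open_plaque_domain _ smooth_plaque_param smooth_function] plaque_param_in_domain
  by (force simp: comp_def)

text \<open>A quantifier over \<open>z\<close> and over the points of the plaque through \<open>z\<close> amounts to a quantifier over the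
  chart domain, because each point lies on its own plaque.\<close>

lemma Morse_on_plaques_iff:
  "(\<forall>z\<in>V. Morse_function (plaque_domain (V, \<phi>) z) (g \<circ> plaque_param (V, \<phi>) z))
    \<longleftrightarrow> (\<forall>z\<in>V. P (\<phi> z) = 0 \<longrightarrow> surj (leafwise_derivative z))"
proof -
  have "plaque_param (V, \<phi>) z (leaf_coords (\<phi> z)) = z" if "z \<in> V" for z
    using that chart_left_inverse by (simp add: plaque_param_def)
  then have "(\<forall>z\<in>V. P (\<phi> z) = 0 \<longrightarrow> surj (leafwise_derivative z))
    \<longleftrightarrow> (\<forall>z\<in>V. \<forall>x\<in>plaque_domain (V, \<phi>) z. P (\<phi> (plaque_param (V, \<phi>) z x)) = 0
          \<longrightarrow> surj (leafwise_derivative (plaque_param (V, \<phi>) z x)))"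
    using centre_in_plaque_domain plaque_param_in_domain by metis
  then show ?thesis
    by (simp add: Morse_function_def smooth_function_on_plaque critical_point_on_plaque_iff
        nondegenerate_on_plaque_iff)
qed

text \<open>By the chain rule, \<open>P (\<phi> z) \<bullet> a\<close> is the derivative of \<open>g\<close> in the direction \<open>D\<psi>(\<phi> z)(a, 0)\<close>, and
  these directions exhaust the tangent space of the plaque.\<close>

lemma polar_equations_eq_0_iff:
  assumes "z \<in> V"
  shows "P (\<phi> z) = 0 \<longleftrightarrow> (\<forall>v\<in>plaque_tangent_space \<phi> z. v \<bullet> gradient g z = 0)"
proof -
  have "(g has_derivative frechet_derivative g (at (\<psi> (\<phi> z)))) (at (\<psi> (\<phi> z)))"
    using smooth_on_has_derivative[OF smooth_function assms] assms by (simp add: chart_left_inverse)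
  from has_derivative_compose[OF chart_inverse_has_derivative this]
  have "((\<lambda>w. g (\<psi> w)) has_derivative (\<lambda>u. frechet_derivative g (at z) (D\<psi> (\<phi> z) u))) (at (\<phi> z))"
    using assms by (simp add: chart_left_inverse)
  then have "frechet_derivative (g \<circ> \<psi>) (at (\<phi> z)) = (\<lambda>u. frechet_derivative g (at z) (D\<psi> (\<phi> z) u))"
    unfolding comp_def by (metis frechet_derivative_at)
  then have "P (\<phi> z) \<bullet> a = frechet_derivative g (at z) (D\<psi> (\<phi> z) (join_coords a 0))" for a
    using polar_equations_inner[of "\<phi> z" a] assms by simp
  then have "P (\<phi> z) \<bullet> a = D\<psi> (\<phi> z) (join_coords a 0) \<bullet> gradient g z" for a
    using smooth_on_has_derivative[OF smooth_function assms]
    by (subst inner_gradient) (auto simp: differentiable_def)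
  then have "(\<forall>v\<in>plaque_tangent_space \<phi> z. v \<bullet> gradient g z = 0) \<longleftrightarrow> (\<forall>a. P (\<phi> z) \<bullet> a = 0)"
    unfolding plaque_tangent_space_eq[OF assms] by simp
  also have "\<dots> \<longleftrightarrow> P (\<phi> z) = 0" by (metis inner_eq_zero_iff inner_zero_left)
  finally show ?thesis by simp
qed

section \<open>Rectifying the polar variety\<close>

text \<open>This map replaces the leaf coordinates by the polar equations, and so flattens the zero set of the
  polar equations to \<open>0 \<times> \<complex>\<^sup>q\<close>.\<close>

definition rectification where
  "rectification w = join_coords (P w) (transverse_coords w)"

lemma rectification_has_derivative:
  assumes "w \<in> \<phi> ` V"
  shows "(rectification has_derivative
    (\<lambda>u. join_coords (frechet_derivative P (at w) u) (transverse_coords u))) (at w)"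
proof -
  have "((\<lambda>w. join_coords (P w) 0 + join_coords 0 (transverse_coords w)) has_derivative
      (\<lambda>u. join_coords (frechet_derivative P (at w) u) 0 + join_coords 0 (transverse_coords u))) (at w)"
    by (intro has_derivative_add bounded_linear.has_derivative[OF bounded_linear_join_leaf]
        bounded_linear.has_derivative[OF bounded_linear_join_transverse]
        bounded_linear.has_derivative[OF bounded_linear_transverse_coords]
        has_derivative_ident polar_equations_has_derivative assms)
  then show ?thesis by (simp flip: join_coords_split add: rectification_def[abs_def])
qed

lemma smooth_rectification: "smooth_on (\<phi> ` V) rectification"
proof -
  have "smooth_on (\<phi> ` V) (\<lambda>w. join_coords (P w) 0)"
    by (rule smooth_on_compose[OF open_image subset_UNIV smooth_polar_equations
          smooth_on_bounded_linear[OF bounded_linear_join_leaf]])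
  moreover have "smooth_on (\<phi> ` V) (\<lambda>w. join_coords 0 (transverse_coords w))"
    by (intro smooth_on_bounded_linear bounded_linear_compose[OF bounded_linear_join_transverse]
        bounded_linear_transverse_coords)
  ultimately have "smooth_on (\<phi> ` V) (\<lambda>w. join_coords (P w) 0 + join_coords 0 (transverse_coords w))"
    by (rule smooth_on_add[OF open_image])
  then show ?thesis by (simp flip: join_coords_split add: rectification_def[abs_def])
qed

text \<open>In block form with respect to \<open>\<complex>\<^sup>d \<times> \<complex>\<^sup>q\<close> the derivative is triangular with diagonal blocks \<open>A\<close> and
  the identity, and a surjective \<open>A\<close> is also injective for reasons of dimension.\<close>

lemma inj_rectification_derivative:
  assumes "z \<in> V" "surj (leafwise_derivative z)"
  shows "inj (frechet_derivative rectification (at (\<phi> z)))"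
proof -
  have z: "\<phi> z \<in> \<phi> ` V" using assms by simp
  have eq: "frechet_derivative rectification (at (\<phi> z)) =
      (\<lambda>u. join_coords (frechet_derivative P (at (\<phi> z)) u) (transverse_coords u))"
    using frechet_derivative_at[OF rectification_has_derivative[OF z]] by simp
  have inj: "inj (leafwise_derivative z)"
    using linear_surjective_imp_injective[OF linear_leafwise_derivative[OF assms(1)] assms(2)] by simp
  have "u = 0" if "frechet_derivative rectification (at (\<phi> z)) u = 0" for u
  proof -
    have 0: "frechet_derivative P (at (\<phi> z)) u = 0" "transverse_coords u = 0"
      using that unfolding eq by (metis join_coords_0 leaf_join, metis join_coords_0 transverse_join)
    then have u: "u = join_coords (leaf_coords u) 0" by (metis join_leaf_transverse)
    then have "leafwise_derivative z (leaf_coords u) = 0"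
      using 0 by (simp add: leafwise_derivative_def)
    then have "leaf_coords u = 0"
      using inj linear_leafwise_derivative[OF assms(1)] by (metis linear_injective_0)
    then show ?thesis using u by simp
  qed
  then show ?thesis
    using linear_injective_0[OF has_derivative_linear[OF rectification_has_derivative[OF z]]] eq by simp
qed

lemma rectification_local_inverse:
  assumes "z \<in> V" "surj (leafwise_derivative z)"
  obtains A T h where "open A" "A \<subseteq> \<phi> ` V" "\<phi> z \<in> A" "open T" "rectification ` A = T" "h ` T = A"
    "\<And>w. w \<in> A \<Longrightarrow> h (rectification w) = w" "\<And>y. y \<in> T \<Longrightarrow> rectification (h y) = y" "smooth_on T h"
  using smooth_inverse_function_theorem[OF open_image smooth_rectification _ inj_rectification_derivative[OF assms]] assms(1)
  by (metis (no_types, lifting) imageI)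

section \<open>Surjectivity of the leafwise derivative and the geometry of the polar variety\<close>

text \<open>Near time \<open>0\<close> a curve in \<open>S\<close> stays in the chart, where the polar equations vanish along it.\<close>

lemma velocity_in_kernel:
  assumes "z \<in> V" "S \<inter> V = {z \<in> V. P (\<phi> z) = 0}" "v \<in> tangent_space S z"
  shows "frechet_derivative P (at (\<phi> z)) (D\<phi> z v) = 0"
proof -
  obtain e \<gamma> where \<gamma>: "e > 0" "\<gamma> ` {-e<..<e} \<subseteq> S" "\<gamma> 0 = z" "(\<gamma> has_vector_derivative v) (at (0::real))"
    using assms(3) unfolding tangent_space_def by blast
  have der: "(\<gamma> has_derivative (\<lambda>t. t *\<^sub>R v)) (at 0)"
    using \<gamma>(4) by (simp add: has_vector_derivative_def)
  have "(\<gamma> \<longlongrightarrow> \<gamma> 0) (nhds 0)"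
    using has_derivative_continuous[OF der] by (simp add: isCont_def tendsto_at_iff_tendsto_nhds)
  then have "\<forall>\<^sub>F t in nhds 0. \<gamma> t \<in> V \<and> t \<in> {-e<..<e}"
    using \<gamma>(1,3) assms(1) open_domain eventually_nhds_in_open[of "{-e<..<e}" 0]
    by (intro eventually_conj) (auto simp: tendsto_def)
  then obtain N where N: "open N" "0 \<in> N" "\<And>t. t \<in> N \<Longrightarrow> \<gamma> t \<in> V \<and> t \<in> {-e<..<e}"
    unfolding eventually_nhds by blast
  have P0: "P (\<phi> (\<gamma> t)) = 0" if "t \<in> N" for t
    using N(3)[OF that] \<gamma>(2) assms(2) by blast
  have "(\<phi> has_derivative D\<phi> z) (at (\<gamma> 0))"
    using chart_has_derivative[OF assms(1)] \<gamma>(3) by simp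
  from has_derivative_compose[OF der this]
  have "((\<lambda>t. \<phi> (\<gamma> t)) has_derivative (\<lambda>t. D\<phi> z (t *\<^sub>R v))) (at 0)" .
  moreover have "(P has_derivative frechet_derivative P (at (\<phi> z))) (at (\<phi> (\<gamma> 0)))"
    using polar_equations_has_derivative[of "\<phi> z"] assms(1) \<gamma>(3) by simp
  ultimately have "((\<lambda>t. P (\<phi> (\<gamma> t))) has_derivative
      (\<lambda>t. frechet_derivative P (at (\<phi> z)) (D\<phi> z (t *\<^sub>R v)))) (at 0)"
    by (rule has_derivative_compose)
  then have "((\<lambda>t. 0) has_derivative
      (\<lambda>t. frechet_derivative P (at (\<phi> z)) (D\<phi> z (t *\<^sub>R v)))) (at (0::real))"
    by (rule has_derivative_transform_within_open[OF _ N(1,2) P0])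
  then have "(\<lambda>t. frechet_derivative P (at (\<phi> z)) (D\<phi> z (t *\<^sub>R v))) = (\<lambda>t. 0)"
    using has_derivative_const has_derivative_unique by blast
  then have "frechet_derivative P (at (\<phi> z)) (D\<phi> z (1 *\<^sub>R v)) = 0" by meson
  then show ?thesis by simp
qed

text \<open>Transversality writes any direction as \<open>s + l\<close> with \<open>s\<close> tangent to \<open>S\<close> and \<open>l\<close> tangent to the leaf.
  Since \<open>DP\<close> kills \<open>s\<close>, all its values are already taken on leaf directions.\<close>

lemma surj_leafwise_derivative_if_transversal:
  assumes "z \<in> V" "S \<inter> V = {z \<in> V. P (\<phi> z) = 0}"
    and dim: "dim (range (frechet_derivative P (at (\<phi> z)))) = 2 * CARD('d)"
    and trans: "{u + v | u v. u \<in> tangent_space S z \<and> v \<in> plaque_tangent_space \<phi> z} = UNIV"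
  shows "surj (leafwise_derivative z)"
proof -
  let ?DP = "frechet_derivative P (at (\<phi> z))"
  have z: "\<phi> z \<in> \<phi> ` V" using assms(1) by simp
  have lin: "linear ?DP"
    using polar_equations_has_derivative[OF z] by (rule has_derivative_linear)
  have "DIM(complex^'d) = 2 * CARD('d)" by simp
  then have "span (range ?DP) = UNIV" using dim dim_eq_full by metis
  then have "surj ?DP"
    using lin by (simp add: linear_subspace_image span_eq_iff[THEN iffD2])
  have "\<exists>a. y = leafwise_derivative z a" for y
  proof -
    obtain u where u: "y = ?DP u" using \<open>surj ?DP\<close> by (metis surjD)
    have "D\<psi> (\<phi> z) u \<in> {u + v | u v. u \<in> tangent_space S z \<and> v \<in> plaque_tangent_space \<phi> z}"
      using trans by simp
    then obtain s l where sl: "D\<psi> (\<phi> z) u = s + l" "s \<in> tangent_space S z" "l \<in> plaque_tangent_space \<phi> z"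
      by blast
    obtain a where a: "l = D\<psi> (\<phi> z) (join_coords a 0)"
      using sl(3) plaque_tangent_space_eq[OF assms(1)] by blast
    have "u = D\<phi> z (s + l)" using sl(1) D\<phi>_D\<psi>[OF assms(1), of u] by simp
    also have "\<dots> = D\<phi> z s + join_coords a 0"
      using a by (simp add: linear_add[OF linear_D\<phi>[OF assms(1)]] D\<phi>_D\<psi>[OF assms(1)])
    finally have "y = ?DP (D\<phi> z s) + leafwise_derivative z a"
      using u by (simp add: linear_add[OF lin] leafwise_derivative_def)
    then show ?thesis using velocity_in_kernel[OF assms(1,2) sl(2)] by auto
  qed
  then show ?thesis by (metis surjI surj_def)
qed

lemma full_rank_if_surj_leafwise_derivative:
  assumes "z \<in> V" "surj (leafwise_derivative z)"
  shows "dim (range (frechet_derivative P (at (\<phi> z)))) = 2 * CARD('d)"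
proof -
  have "range (leafwise_derivative z) \<subseteq> range (frechet_derivative P (at (\<phi> z)))"
    by (auto simp: leafwise_derivative_def)
  then have "range (frechet_derivative P (at (\<phi> z))) = UNIV"
    unfolding assms(2) by (rule top.extremum_uniqueI)
  then show ?thesis by simp
qed

text \<open>Given a direction \<open>u\<close>, let \<open>c \<in> 0 \<times> \<complex>\<^sup>q\<close> have the same transverse component as \<open>u\<close> has in the chart.
  The line in direction \<open>c\<close> is pulled back by the rectification to a curve in \<open>S\<close>. The rectification
  preserves transverse coordinates, so the velocity \<open>s\<close> of this curve has the same transverse
  component as \<open>u\<close>, and \<open>u - s\<close> is tangent to the leaf.\<close>

lemma transversal_if_surj_leafwise_derivative:
  assumes "z \<in> V" "P (\<phi> z) = 0" "surj (leafwise_derivative z)" "S \<inter> V = {z \<in> V. P (\<phi> z) = 0}"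
  shows "{u + v | u v. u \<in> tangent_space S z \<and> v \<in> plaque_tangent_space \<phi> z} = UNIV"
proof -
  obtain A T h where A: "open A" "A \<subseteq> \<phi> ` V" "\<phi> z \<in> A" and T: "open T"
    "rectification ` A = T" "h ` T = A"
    and inv: "\<And>w. w \<in> A \<Longrightarrow> h (rectification w) = w" "\<And>y. y \<in> T \<Longrightarrow> rectification (h y) = y"
    and h: "smooth_on T h"
    by (rule rectification_local_inverse[OF assms(1,3)]) blast
  define y0 where "y0 = rectification (\<phi> z)"
  have y0: "y0 \<in> T" "h y0 = \<phi> z" using A T inv by (auto simp: y0_def)
  have zD: "\<phi> z \<in> \<phi> ` V" using A by blast
  have "\<exists>s l. u = s + l \<and> s \<in> tangent_space S z \<and> l \<in> plaque_tangent_space \<phi> z" for u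
  proof -
    define c where "c = join_coords (0::complex^'d) (transverse_coords (D\<phi> z u))"
    define s' where "s' = frechet_derivative h (at y0) c"
    define s where "s = D\<psi> (\<phi> z) s'"
    have hder: "(h has_derivative frechet_derivative h (at y0)) (at y0)"
      by (rule smooth_on_has_derivative[OF h y0(1)])
    have "frechet_derivative rectification (at (h y0)) s' = c"
      unfolding s'_def
      using hder rectification_has_derivative[OF zD] y0
      by (intro frechet_derivative_left_inverse[where f = h and h = rectification, OF T(1) y0(1)] inv(2))
        (auto simp: differentiable_def)
    then have "c = join_coords (frechet_derivative P (at (\<phi> z)) s') (transverse_coords s')"
      using frechet_derivative_at[OF rectification_has_derivative[OF zD], symmetric] y0(2) by simp
    then have "transverse_coords s' = transverse_coords c" by simp
    then have l: "u - s \<in> plaque_tangent_space \<phi> z"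
      unfolding plaque_tangent_space_def s_def c_def
      by (simp add: linear_diff[OF linear_D\<phi>[OF assms(1)]] D\<phi>_D\<psi>[OF assms(1)]
          linear_diff[OF bounded_linear.linear[OF bounded_linear_transverse_coords]])
    \<comment> \<open>The rectified polar variety contains this line, because \<open>P\<close> vanishes at \<open>\<phi> z\<close> and \<open>c\<close> has no leaf component.\<close>
    define line where "line = (\<lambda>t::real. y0 + t *\<^sub>R c)"
    have line_der: "(line has_derivative (\<lambda>t. t *\<^sub>R c)) (at t)" for t
      unfolding line_def by (auto intro!: derivative_eq_intros)
    have "open (line -` T)"
      by (intro open_vimage T(1) continuous_at_imp_continuous_on ballI has_derivative_continuous[OF line_der])
    moreover have "0 \<in> line -` T" using y0 by (simp add: line_def)
    ultimately obtain e where e: "e > 0" "ball 0 e \<subseteq> line -` T"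
      using open_contains_ball by blast
    have I: "{-e<..<e} = ball 0 e" by (auto simp: dist_real_def)
    let ?\<gamma> = "\<lambda>t. \<psi> (h (line t))"
    have smooth_line: "smooth_on {-e<..<e} line"
      unfolding line_def
      by (intro smooth_on_add smooth_on_const smooth_on_bounded_linear bounded_linear_scaleR_left) simp
    have line_T: "line t \<in> T" if "t \<in> {-e<..<e}" for t
      using that e(2) unfolding I by blast
    have h_line: "h (line t) \<in> \<phi> ` V" if "t \<in> {-e<..<e}" for t
      using line_T[OF that] T(3) A(2) by blast
    have smooth_h_line: "smooth_on {-e<..<e} (\<lambda>t. h (line t))"
      by (rule smooth_on_compose[OF _ _ smooth_line h]) (use line_T in auto)
    have "smooth_on {-e<..<e} ?\<gamma>"
      by (rule smooth_on_compose[OF _ _ smooth_h_line smooth_chart_inverse])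
        (use h_line in \<open>auto simp: image_subset_iff\<close>)
    moreover have "?\<gamma> ` {-e<..<e} \<subseteq> S"
    proof (intro image_subsetI)
      fix t assume "t \<in> {-e<..<e}"
      note t = line_T[OF this] and hA = h_line[OF this]
      have "P (h (line t)) = leaf_coords (rectification (h (line t)))"
        by (simp add: rectification_def)
      also have "\<dots> = leaf_coords (line t)" using inv(2)[OF t] by simp
      also have "\<dots> = leaf_coords (join_coords (P (\<phi> z)) (transverse_coords (\<phi> z)) + t *\<^sub>R c)"
        by (simp add: line_def y0_def rectification_def)
      also have "\<dots> = 0"
        by (simp add: assms(2) c_def linear_add linear_scale bounded_linear.linear[OF bounded_linear_leaf_coords])
      finally have "?\<gamma> t \<in> {z \<in> V. P (\<phi> z) = 0}"
        using chart_inverse_in_domain[OF hA] chart_right_inverse[OF hA] by simp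
      then show "?\<gamma> t \<in> S" unfolding assms(4)[symmetric] by (rule IntD1)
    qed
    moreover have "?\<gamma> 0 = z" using y0 assms(1) by (simp add: line_def chart_left_inverse)
    moreover have "(?\<gamma> has_vector_derivative s) (at 0)"
    proof -
      have "((\<lambda>t. h (line t)) has_derivative (\<lambda>t. frechet_derivative h (at y0) (t *\<^sub>R c))) (at 0)"
        by (rule has_derivative_compose[OF line_der]) (use hder in \<open>simp add: line_def\<close>)
      then have "((\<lambda>t. h (line t)) has_derivative (\<lambda>t. t *\<^sub>R s')) (at 0)"
        by (simp add: s'_def linear_scale[OF has_derivative_linear[OF hder]])
      then have "(?\<gamma> has_derivative (\<lambda>t. D\<psi> (\<phi> z) (t *\<^sub>R s'))) (at 0)"
        by (rule has_derivative_compose) (use chart_inverse_has_derivative[OF zD] y0 in \<open>simp add: line_def\<close>)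
      then show ?thesis
        by (simp add: has_vector_derivative_def s_def linear_scale[OF linear_D\<psi>[OF zD]])
    qed
    ultimately have "s \<in> tangent_space S z" unfolding tangent_space_def using e(1) by blast
    then show ?thesis using l by (intro exI[of _ s] exI[of _ "u - s"]) simp
  qed
  then show ?thesis by blast
qed

text \<open>The flattening diffeomorphism is the chart, followed by the rectification, followed by a real-linear
  isomorphism \<open>L\<close> that identifies \<open>\<complex>\<^bsup>d+q\<^esup>\<close> with \<open>\<complex>\<^sup>n\<close>.\<close>

lemma submanifold_chart_if_surj_leafwise_derivative:
  assumes "CARD('n) = CARD('d) + CARD('q)"
    and "z \<in> V" "surj (leafwise_derivative z)" "S \<inter> V = {z \<in> V. P (\<phi> z) = 0}"
  shows "\<exists>V' W (\<Phi> :: complex^'n \<Rightarrow> complex^'n) E. z \<in> V' \<and> diffeomorphism V' W \<Phi> \<and> subspace E \<and>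
    dim E + 2 * CARD('d) = DIM(complex^'n) \<and> \<Phi> ` (S \<inter> V') = W \<inter> E"
proof -
  obtain A T h where A: "open A" "A \<subseteq> \<phi> ` V" "\<phi> z \<in> A" and T: "open T"
    "rectification ` A = T" "h ` T = A"
    and inv: "\<And>w. w \<in> A \<Longrightarrow> h (rectification w) = w" "\<And>y. y \<in> T \<Longrightarrow> rectification (h y) = y"
    and h: "smooth_on T h"
    by (rule rectification_local_inverse[OF assms(2,3)]) blast
  have "DIM(complex^('d + 'q)) = DIM(complex^'n)" using assms(1) by simp
  then obtain L :: "complex^('d + 'q) \<Rightarrow> complex^'n" and L' where
    L: "linear L" "linear L'" "\<And>x. L' (L x) = x" "\<And>y. L (L' y) = y"
    using isomorphisms_UNIV_UNIV by metis
  have bL: "bounded_linear L" "bounded_linear L'"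
    using L(1,2) by (simp_all add: linear_conv_bounded_linear)
  define V' where "V' = {x \<in> V. \<phi> x \<in> A}"
  define W where "W = L' -` T"
  define \<Phi> where "\<Phi> = (\<lambda>x. L (rectification (\<phi> x)))"
  define \<Theta> where "\<Theta> = (\<lambda>y. \<psi> (h (L' y)))"
  define E where "E = range (\<lambda>y. L (join_coords 0 y))"
  have "V' = V \<inter> \<phi> -` A" by (auto simp: V'_def)
  then have openV': "open V'"
    using open_domain A(1) chart_has_derivative
    by (metis continuous_at_imp_continuous_on continuous_open_preimage has_derivative_continuous)
  have openW: "open W"
    unfolding W_def using T(1) linear_continuous_on[OF bL(2)] by (intro open_vimage)
  have \<Phi>W: "\<Phi> x \<in> W" if "x \<in> V'" for x
    using that T L by (auto simp: V'_def W_def \<Phi>_def)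
  have \<Theta>V: "\<Theta> y \<in> V'" if "y \<in> W" for y
  proof -
    have "h (L' y) \<in> A" using that T by (auto simp: W_def)
    then show ?thesis
      using A(2) chart_right_inverse chart_inverse_in_domain by (auto simp: V'_def \<Theta>_def)
  qed
  have \<Theta>\<Phi>: "\<Theta> (\<Phi> x) = x" if "x \<in> V'" for x
    using that L inv chart_left_inverse by (simp add: V'_def \<Phi>_def \<Theta>_def)
  have \<Phi>\<Theta>: "\<Phi> (\<Theta> y) = y" if "y \<in> W" for y
  proof -
    have "h (L' y) \<in> \<phi> ` V" using that T A by (auto simp: W_def)
    then show ?thesis
      using that L inv chart_right_inverse by (simp add: W_def \<Phi>_def \<Theta>_def)
  qed
  have bij: "bij_betw \<Phi> V' W"
    using \<Phi>W \<Theta>V \<Theta>\<Phi> \<Phi>\<Theta> by (intro bij_betwI) auto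
  have "smooth_on V' (\<lambda>x. rectification (\<phi> x))"
    by (rule smooth_on_compose[OF openV' _ smooth_on_subset[OF smooth_chart] smooth_rectification])
      (auto simp: V'_def)
  then have smooth\<Phi>: "smooth_on V' \<Phi>"
    unfolding \<Phi>_def
    by (rule smooth_on_compose[OF openV' subset_UNIV _ smooth_on_bounded_linear[OF bL(1)]])
  have hL': "smooth_on W (\<lambda>y. h (L' y))"
    by (rule smooth_on_compose[OF openW _ smooth_on_bounded_linear[OF bL(2)] h]) (auto simp: W_def)
  have smooth\<Theta>: "smooth_on W \<Theta>"
    unfolding \<Theta>_def
    by (rule smooth_on_compose[OF openW _ hL' smooth_chart_inverse]) (use T A in \<open>auto simp: W_def\<close>)
  have "smooth_on W (inv_into V' \<Phi>)"
  proof (rule smooth_on_cong[OF openW smooth\<Theta>])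
    fix y assume "y \<in> W"
    then show "\<Theta> y = inv_into V' \<Phi> y"
      using \<Theta>V \<Phi>\<Theta> bij by (metis bij_betw_imp_inj_on inv_into_f_f)
  qed
  then have diffeo: "diffeomorphism V' W \<Phi>"
    using openV' openW bij smooth\<Phi> by (simp add: diffeomorphism_def)
  have linE: "linear (\<lambda>y. L (join_coords 0 y))"
    using linear_compose[OF bounded_linear.linear[OF bounded_linear_join_transverse] L(1)]
    by (simp add: comp_def)
  have injE: "inj (\<lambda>y. L (join_coords 0 y))"
    by (rule injI) (metis L(3) transverse_join)
  have "dim E = DIM(complex^'q)"
    unfolding E_def using dim_image_eq[OF linE, of UNIV] injE by simp
  then have dimE: "dim E + 2 * CARD('d) = DIM(complex^'n)" using assms(1) by simp
  have subE: "subspace E" unfolding E_def using linE by (simp add: linear_subspace_image)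
  have E_iff: "L y \<in> E \<longleftrightarrow> leaf_coords y = 0" for y
  proof
    assume "L y \<in> E"
    then obtain y' where "L y = L (join_coords 0 y')" unfolding E_def by blast
    then have "y = join_coords 0 y'" by (metis L(3))
    then show "leaf_coords y = 0" by simp
  next
    assume "leaf_coords y = 0"
    then have "y = join_coords 0 (transverse_coords y)" by (metis join_leaf_transverse)
    then show "L y \<in> E" unfolding E_def by (metis (mono_tags) rangeI)
  qed
  have "\<Phi> x \<in> E \<longleftrightarrow> x \<in> S" if "x \<in> V'" for x
    using that assms(4) by (auto simp: \<Phi>_def E_iff rectification_def V'_def)
  then have "\<Phi> ` (S \<inter> V') = W \<inter> E"
    using \<Phi>W \<Theta>V \<Phi>\<Theta> by (auto simp: image_iff) (metis IntI)
  moreover have "z \<in> V'" using assms(2) A(3) by (simp add: V'_def)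
  ultimately show ?thesis using diffeo subE dimE by blast
qed

end

section \<open>Morse structures and polar varieties\<close>

lemma foliation_chart:
  assumes "regular_holomorphic_foliation W \<F>" "(V, \<phi>) \<in> \<F>"
  shows "V \<subseteq> W" "foliated_chart (V, \<phi>)"
proof -
  have "fst (V, \<phi>) \<subseteq> (\<Union>c\<in>\<F>. fst c)" using assms(2) by blast
  then show "V \<subseteq> W" "foliated_chart (V, \<phi>)"
    using assms unfolding regular_holomorphic_foliation_def by simp_all
qed

lemma polar_variety_in_chart:
  fixes \<F> :: "('n::finite, 'd::finite, 'q::finite) chart set"
  assumes "regular_holomorphic_foliation (U - {0}) \<F>" "(V, \<phi>) \<in> \<F>" "smooth_on U g"
  shows "(polar_variety U \<F> g - {0}) \<inter> V = {z \<in> V. polar_equations (V, \<phi>) g (\<phi> z) = 0}"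
proof -
  note V = foliation_chart[OF assms(1,2)]
  interpret function_in_chart V \<phi> g
    by unfold_locales (use V smooth_on_subset[OF assms(3), of V] in auto)
  show ?thesis
    using V(1) polar_equations_eq_0_iff leaf_tangent_space_eq_plaque[OF assms(1,2)]
    by (auto simp: polar_variety_def)
qed

text \<open>The leaves cover the domain, so a condition on all points of all leaves is a condition on all points.\<close>

lemma carries_Morse_structure_iff:
  assumes "regular_holomorphic_foliation (U - {0}) \<F>"
  shows "carries_Morse_structure U \<F> g \<longleftrightarrow>
    (\<forall>c\<in>\<F>. \<forall>z\<in>fst c. Morse_function (plaque_domain c z) (g \<circ> plaque_param c z))"
proof -
  have "z \<in> leaf \<F> z" for z by (simp add: leaf_def)
  moreover have "fst c \<subseteq> U - {0}" if "c \<in> \<F>" for c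
    using assms that by (auto simp: regular_holomorphic_foliation_def)
  ultimately show ?thesis
    unfolding carries_Morse_structure_def Morse_on_leaf_def leaves_def by blast
qed

text \<open>Both sides say that the leafwise derivative is surjective at every point of \<open>M\<^sup>*\<close>, in every chart.\<close>

theorem theorem2p1:
  fixes U :: "(complex^'n) set"
    and \<F> :: "('n::finite, 'd::finite, 'q::finite) chart set"
    and g :: "complex^'n \<Rightarrow> real"
  assumes "CARD('n) = CARD('d) + CARD('q)"
    and "open U" and "0 \<in> U"
    and "regular_holomorphic_foliation (U - {0}) \<F>" and "singular_point \<F> 0"
    and "Morse_function U g"
    and "{p \<in> U. critical_point g p} = {0}"
    and "Morse_index g 0 = 0"
  shows "carries_Morse_structure U \<F> g \<longleftrightarrow>
    (smooth_submanifold (2 * CARD('d)) (polar_variety U \<F> g - {0}) \<and>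
     reduced_polar_variety U \<F> g \<and>
     transversal_to_foliation (polar_variety U \<F> g - {0}) \<F>)"
proof -
  let ?S = "polar_variety U \<F> g - {0}"
  have g: "smooth_on U g" using assms(6) by (simp add: Morse_function_def)
  have cover: "\<exists>V \<phi>. (V, \<phi>) \<in> \<F> \<and> z \<in> V" if "z \<in> ?S" for z
  proof -
    have "z \<in> U - {0}" using that by (auto simp: polar_variety_def)
    then have "z \<in> (\<Union>c\<in>\<F>. fst c)" using assms(4) by (simp add: regular_holomorphic_foliation_def)
    then show ?thesis by force
  qed
  have loc: "function_in_chart V \<phi> g" if "(V, \<phi>) \<in> \<F>" for V \<phi>
    by unfold_locales
      (use foliation_chart[OF assms(4) that] smooth_on_subset[OF g, of V] in auto)
  note S = polar_variety_in_chart[OF assms(4) _ g]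
  note tangent = leaf_tangent_space_eq_plaque[OF assms(4)]
  have polar_iff: "z \<in> ?S \<longleftrightarrow> polar_equations (V, \<phi>) g (\<phi> z) = 0"
    if "(V, \<phi>) \<in> \<F>" "z \<in> V" for V \<phi> z
    using S[OF that(1)] that(2) by blast
  have "carries_Morse_structure U \<F> g \<longleftrightarrow>
      (\<forall>V \<phi>. (V, \<phi>) \<in> \<F> \<longrightarrow>
        (\<forall>z\<in>V. Morse_function (plaque_domain (V, \<phi>) z) (g \<circ> plaque_param (V, \<phi>) z)))"
    unfolding carries_Morse_structure_iff[OF assms(4)] by (simp add: Ball_def split_paired_All)
  also have "\<dots> \<longleftrightarrow>
      (\<forall>V \<phi>. (V, \<phi>) \<in> \<F> \<longrightarrow> (\<forall>z\<in>V. polar_equations (V, \<phi>) g (\<phi> z) = 0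
        \<longrightarrow> surj (function_in_chart.leafwise_derivative V \<phi> g z)))"
    by (simp add: function_in_chart.Morse_on_plaques_iff[OF loc] cong: imp_cong)
  also have "\<dots> \<longleftrightarrow>
      (\<forall>V \<phi> z. (V, \<phi>) \<in> \<F> \<longrightarrow> z \<in> V \<longrightarrow> z \<in> ?S \<longrightarrow> surj (function_in_chart.leafwise_derivative V \<phi> g z))"
    using polar_iff by blast
  finally have Morse: "carries_Morse_structure U \<F> g \<longleftrightarrow>
      (\<forall>V \<phi> z. (V, \<phi>) \<in> \<F> \<longrightarrow> z \<in> V \<longrightarrow> z \<in> ?S \<longrightarrow> surj (function_in_chart.leafwise_derivative V \<phi> g z))" .
  show ?thesis
  proof
    assume "carries_Morse_structure U \<F> g"
    then have surj: "surj (function_in_chart.leafwise_derivative V \<phi> g z)"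
      if "(V, \<phi>) \<in> \<F>" "z \<in> V" "z \<in> ?S" for V \<phi> z
      using that Morse by blast
    have "smooth_submanifold (2 * CARD('d)) ?S"
      unfolding smooth_submanifold_def
    proof
      fix z assume z: "z \<in> ?S"
      then obtain V \<phi> where c: "(V, \<phi>) \<in> \<F>" "z \<in> V" using cover by blast
      show "\<exists>V' W (\<Phi> :: complex^'n \<Rightarrow> complex^'n) E. z \<in> V' \<and> diffeomorphism V' W \<Phi> \<and> subspace E \<and>
          dim E + 2 * CARD('d) = DIM(complex^'n) \<and> \<Phi> ` (?S \<inter> V') = W \<inter> E"
        by (rule function_in_chart.submanifold_chart_if_surj_leafwise_derivative
            [OF loc[OF c(1)] assms(1) c(2) surj[OF c z] S[OF c(1)]])
    qed
    moreover have "reduced_polar_variety U \<F> g"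
      unfolding reduced_polar_variety_def
      using function_in_chart.full_rank_if_surj_leafwise_derivative[OF loc _ surj] by auto
    moreover have "transversal_to_foliation ?S \<F>"
      unfolding transversal_to_foliation_def
    proof
      fix z assume z: "z \<in> ?S"
      then obtain V \<phi> where c: "(V, \<phi>) \<in> \<F>" "z \<in> V" using cover by blast
      have "polar_equations (V, \<phi>) g (\<phi> z) = 0" using polar_iff[OF c] z by blast
      then show "{u + v | u v. u \<in> tangent_space ?S z \<and> v \<in> leaf_tangent_space \<F> z} = UNIV"
        unfolding tangent[OF c]
        by (rule function_in_chart.transversal_if_surj_leafwise_derivative
            [OF loc[OF c(1)] c(2) _ surj[OF c z] S[OF c(1)]])
    qed
    ultimately show "smooth_submanifold (2 * CARD('d)) ?S \<and> reduced_polar_variety U \<F> g \<and>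
        transversal_to_foliation ?S \<F>" by blast
  next
    assume *: "smooth_submanifold (2 * CARD('d)) ?S \<and> reduced_polar_variety U \<F> g \<and>
        transversal_to_foliation ?S \<F>"
    have "surj (function_in_chart.leafwise_derivative V \<phi> g z)"
      if c: "(V, \<phi>) \<in> \<F>" "z \<in> V" and z: "z \<in> ?S" for V \<phi> z
    proof (rule function_in_chart.surj_leafwise_derivative_if_transversal[OF loc[OF c(1)] c(2) S[OF c(1)]])
      show "dim (range (frechet_derivative (polar_equations (V, \<phi>) g) (at (\<phi> z)))) = 2 * CARD('d)"
        using * c z unfolding reduced_polar_variety_def by blast
      show "{u + v | u v. u \<in> tangent_space ?S z \<and> v \<in> plaque_tangent_space \<phi> z} = UNIV"
        using * z unfolding transversal_to_foliation_def tangent[OF c, symmetric] by blast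
    qed
    then show "carries_Morse_structure U \<F> g" using Morse by blast
  qed
qed

end
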